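(* Let $k\ge2$. For every $\varepsilon>0$ there exists $\tau>0$ such that for every $n\ge1$ and every function $f=(f_1,\ldots,f_k):\Omega^n\to\Delta_k$ satisfying $\mathrm{Inf}_j^{\le\log(1/\tau)}(f_i)\le\tau$ for all $i\in[k]$ and $j\in[n]$, we have $\mathrm{OBJ}(f)\le C(k)+\varepsilon$.
   Context: $[k]=\{1,\ldots,k\}$, $\Omega=[k]$ with the uniform probability measure, $\Omega^n$ with the product measure; $\Delta_k=\{x\in\mathbb{R}^k: x_i\ge0\ \forall i,\ \sum_ix_i\le1\}$. Fix an orthonormal basis $X_0\equiv1,X_1,\ldots,X_{k-1}$ of real functions on $\Omega$. For a multi-index $\sigma\in\{0,\ldots,k-1\}^n$ let $X_\sigma(\omega)=\prod_{i=1}^nX_{\sigma_i}(\omega_i)$ and $|\sigma|=\#\{i:\sigma_i\ne0\}$; every $g:\Omega^n\to\mathbb{R}$ has a unique expansion $g=\sum_\sigma\hat g(\sigma)X_\sigma$. Define $\mathrm{Inf}_j^{\le m}(g)=\sum_{|\sigma|\le m,\ \sigma_j\ne0}\hat g(\sigma)^2$ and $\mathrm{OBJ}(f)=\sum_{i=1}^k\sum_{|\sigma|=1}\hat f_i(\sigma)^2$. $C(k)=\sup\{\sum_{j=1}^k\|\int_{\mathbb{R}^{k-1}}xh_j(x)\,d\gamma_{k-1}(x)\|_2^2:\ h_j\ge0,\ \sum_jh_j\le1\}$, with $\gamma_{k-1}$ the standard Gaussian measure on $\mathbb{R}^{k-1}$. *)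

theory Defs
  imports "HOL-Probability.Probability"
begin

(* Vectors and points of product spaces indexed by a finite set I of naturals are functions on
   nat that are read only on I.  Where uniqueness matters (points of Omega^n, multi-indices,
   coefficient families, points of R^(k-1)) they are undefined off I (PiE, extensional, PiM). *)

definition omega :: "nat \<Rightarrow> nat set" where
  "omega k = {1..k}"

definition cube :: "nat \<Rightarrow> nat \<Rightarrow> (nat \<Rightarrow> nat) set" where
  "cube k n = {1..n} \<rightarrow>\<^sub>E omega k"

definition solid_simplex :: "nat \<Rightarrow> (nat \<Rightarrow> real) set" where
  "solid_simplex k = {x. (\<forall>i\<in>{1..k}. 0 \<le> x i) \<and> (\<Sum>i\<in>{1..k}. x i) \<le> 1}"

definition orthonormal_basis :: "nat \<Rightarrow> (nat \<Rightarrow> nat \<Rightarrow> real) \<Rightarrow> bool" where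
  "orthonormal_basis k X \<longleftrightarrow>
     (\<forall>a<k. \<forall>b<k. (\<integral>w. X a w * X b w \<partial>uniform_count_measure (omega k)) = (if a = b then 1 else 0)) \<and>
     (\<forall>g. \<exists>c. \<forall>w\<in>omega k. g w = (\<Sum>a<k. c a * X a w))"

definition multi_indices :: "nat \<Rightarrow> nat \<Rightarrow> (nat \<Rightarrow> nat) set" where
  "multi_indices k n = {1..n} \<rightarrow>\<^sub>E {..<k}"

definition index_weight :: "nat \<Rightarrow> (nat \<Rightarrow> nat) \<Rightarrow> nat" where
  "index_weight n \<sigma> = card {i\<in>{1..n}. \<sigma> i \<noteq> 0}"

definition basis_prod :: "nat \<Rightarrow> (nat \<Rightarrow> nat \<Rightarrow> real) \<Rightarrow> (nat \<Rightarrow> nat) \<Rightarrow> (nat \<Rightarrow> nat) \<Rightarrow> real" where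
  "basis_prod n X \<sigma> w = (\<Prod>i\<in>{1..n}. X (\<sigma> i) (w i))"

definition is_expansion ::
  "nat \<Rightarrow> nat \<Rightarrow> (nat \<Rightarrow> nat \<Rightarrow> real) \<Rightarrow> ((nat \<Rightarrow> nat) \<Rightarrow> real) \<Rightarrow> ((nat \<Rightarrow> nat) \<Rightarrow> real) \<Rightarrow> bool" where
  "is_expansion k n X g c \<longleftrightarrow> c \<in> extensional (multi_indices k n) \<and>
     (\<forall>w\<in>cube k n. g w = (\<Sum>\<sigma>\<in>multi_indices k n. c \<sigma> * basis_prod n X \<sigma> w))"

(* Well defined for orthonormal bases: see ex1_expansion and fourier_coeff_eq below. *)
definition fourier_coeff ::
  "nat \<Rightarrow> nat \<Rightarrow> (nat \<Rightarrow> nat \<Rightarrow> real) \<Rightarrow> ((nat \<Rightarrow> nat) \<Rightarrow> real) \<Rightarrow> (nat \<Rightarrow> nat) \<Rightarrow> real" where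
  "fourier_coeff k n X g = (THE c. is_expansion k n X g c)"

(* The degree bound m is real since it is instantiated with a logarithm. *)
definition low_influence ::
  "nat \<Rightarrow> nat \<Rightarrow> (nat \<Rightarrow> nat \<Rightarrow> real) \<Rightarrow> real \<Rightarrow> nat \<Rightarrow> ((nat \<Rightarrow> nat) \<Rightarrow> real) \<Rightarrow> real" where
  "low_influence k n X m j g =
     (\<Sum>\<sigma>\<in>{\<sigma>\<in>multi_indices k n. real (index_weight n \<sigma>) \<le> m \<and> \<sigma> j \<noteq> 0}. (fourier_coeff k n X g \<sigma>)\<^sup>2)"

definition OBJ ::
  "nat \<Rightarrow> nat \<Rightarrow> (nat \<Rightarrow> nat \<Rightarrow> real) \<Rightarrow> ((nat \<Rightarrow> nat) \<Rightarrow> nat \<Rightarrow> real) \<Rightarrow> real" where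
  "OBJ k n X f =
     (\<Sum>i\<in>{1..k}. \<Sum>\<sigma>\<in>{\<sigma>\<in>multi_indices k n. index_weight n \<sigma> = 1}. (fourier_coeff k n X (\<lambda>w. f w i) \<sigma>)\<^sup>2)"

definition std_gaussian :: "nat \<Rightarrow> (nat \<Rightarrow> real) measure" where
  "std_gaussian d = PiM {1..d} (\<lambda>_. std_normal_distribution)"

(* L2_set is the Euclidean norm; the vector-valued integral is taken componentwise. *)
definition gaussian_objective :: "nat \<Rightarrow> (nat \<Rightarrow> (nat \<Rightarrow> real) \<Rightarrow> real) \<Rightarrow> real" where
  "gaussian_objective k h =
     (\<Sum>j\<in>{1..k}. (L2_set (\<lambda>l. \<integral>x. x l * h j x \<partial>std_gaussian (k - 1)) {1..k - 1})\<^sup>2)"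

definition fractional_partition :: "nat \<Rightarrow> (nat \<Rightarrow> (nat \<Rightarrow> real) \<Rightarrow> real) \<Rightarrow> bool" where
  "fractional_partition k h \<longleftrightarrow>
     (\<forall>j\<in>{1..k}. h j \<in> borel_measurable (std_gaussian (k - 1))) \<and>
     (\<forall>x\<in>space (std_gaussian (k - 1)). (\<forall>j\<in>{1..k}. 0 \<le> h j x) \<and> (\<Sum>j\<in>{1..k}. h j x) \<le> 1)"

(* Sup of a nonempty bounded set of reals: see gaussian_objective_nonempty and
   gaussian_objective_bdd_above below. *)
definition gaussian_constant :: "nat \<Rightarrow> real" where
  "gaussian_constant k = Sup {gaussian_objective k h | h. fractional_partition k h}"

lemma finite_multi_indices: "finite (multi_indices k n)"
  by (simp add: multi_indices_def finite_PiE)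

lemma finite_cube: "finite (cube k n)"
  by (simp add: cube_def omega_def finite_PiE)

lemma basis_orthonormal:
  assumes "orthonormal_basis k X" "a < k" "b < k"
  shows "(\<Sum>w\<in>omega k. X a w * X b w) = (if a = b then real k else 0)"
proof -
  have "(\<Sum>w\<in>omega k. X a w * X b w) / real k = (if a = b then 1 else 0)"
    using assms by (simp add: orthonormal_basis_def integral_uniform_count_measure omega_def)
  moreover have "real k \<noteq> 0" using assms by simp
  ultimately show ?thesis by (simp add: field_simps split: if_splits)
qed

lemma basis_complete:
  assumes X: "orthonormal_basis k X" and u: "u \<in> omega k" and v: "v \<in> omega k"
  shows "(\<Sum>a<k. X a u * X a v) = (if u = v then real k else 0)"
proof -
  have k: "real k \<noteq> 0" using u by (auto simp: omega_def)
  define g where "g = (\<lambda>w. if w = u then 1 else (0::real))"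
  obtain c where c: "\<And>w. w \<in> omega k \<Longrightarrow> g w = (\<Sum>a<k. c a * X a w)"
    using X unfolding orthonormal_basis_def by meson
  have cb: "X b u = real k * c b" if b: "b < k" for b
  proof -
    have "X b u = (\<Sum>w\<in>omega k. g w * X b w)"
      using u by (simp add: g_def omega_def if_distrib[of "\<lambda>x. x * _"] sum.delta cong: if_cong)
    also have "\<dots> = (\<Sum>w\<in>omega k. \<Sum>a<k. c a * (X a w * X b w))"
      by (intro sum.cong refl) (simp add: c sum_distrib_right mult.assoc)
    also have "\<dots> = (\<Sum>a<k. c a * (\<Sum>w\<in>omega k. X a w * X b w))"
      by (subst sum.swap) (simp add: sum_distrib_left)
    also have "\<dots> = (\<Sum>a<k. if a = b then real k * c b else 0)"
      using b by (intro sum.cong refl) (simp add: basis_orthonormal[OF X])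
    also have "\<dots> = real k * c b" using b by simp
    finally show ?thesis .
  qed
  have "(\<Sum>a<k. X a u * X a v) = real k * (\<Sum>a<k. c a * X a v)"
    by (simp add: cb sum_distrib_left mult.assoc)
  also have "\<dots> = real k * g v" using c[OF v] by simp
  finally show ?thesis by (simp add: g_def)
qed

lemma prod_delta:
  fixes r :: real
  assumes "\<sigma> \<in> {1..n::nat} \<rightarrow>\<^sub>E A" "\<rho> \<in> {1..n} \<rightarrow>\<^sub>E B"
  shows "(\<Prod>i\<in>{1..n}. if \<sigma> i = \<rho> i then r else 0) = (if \<sigma> = \<rho> then r ^ n else 0)"
proof (cases "\<sigma> = \<rho>")
  case False
  then obtain i where "i \<in> {1..n}" "\<sigma> i \<noteq> \<rho> i"
    using assms by (metis PiE_arb ext)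
  then show ?thesis using False by auto
qed simp

lemma basis_prod_orthonormal:
  assumes X: "orthonormal_basis k X"
    and s: "\<sigma> \<in> multi_indices k n" and r: "\<rho> \<in> multi_indices k n"
  shows "(\<Sum>w\<in>cube k n. basis_prod n X \<sigma> w * basis_prod n X \<rho> w) = (if \<sigma> = \<rho> then real k ^ n else 0)"
proof -
  have "(\<Sum>w\<in>cube k n. basis_prod n X \<sigma> w * basis_prod n X \<rho> w)
      = (\<Prod>i\<in>{1..n}. \<Sum>u\<in>omega k. X (\<sigma> i) u * X (\<rho> i) u)"
    unfolding cube_def basis_prod_def prod.distrib[symmetric]
    by (rule prod_sum_PiE[symmetric]) (auto simp: omega_def)
  also have "\<dots> = (\<Prod>i\<in>{1..n}. if \<sigma> i = \<rho> i then real k else 0)"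
    using s r by (intro prod.cong refl basis_orthonormal[OF X])
      (auto simp: multi_indices_def PiE_iff)
  finally show ?thesis using prod_delta[of \<sigma> n _ \<rho>] s r by (simp add: multi_indices_def)
qed

lemma basis_prod_complete:
  assumes X: "orthonormal_basis k X" and w: "w \<in> cube k n" and z: "z \<in> cube k n"
  shows "(\<Sum>\<sigma>\<in>multi_indices k n. basis_prod n X \<sigma> w * basis_prod n X \<sigma> z) = (if w = z then real k ^ n else 0)"
proof -
  have "(\<Sum>\<sigma>\<in>multi_indices k n. basis_prod n X \<sigma> w * basis_prod n X \<sigma> z)
      = (\<Prod>i\<in>{1..n}. \<Sum>a<k. X a (w i) * X a (z i))"
    unfolding multi_indices_def basis_prod_def prod.distrib[symmetric]
    by (rule prod_sum_PiE[symmetric]) auto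
  also have "\<dots> = (\<Prod>i\<in>{1..n}. if w i = z i then real k else 0)"
    using w z by (intro prod.cong refl basis_complete[OF X]) (auto simp: cube_def PiE_iff)
  finally show ?thesis using prod_delta[of w n _ z] w z by (simp add: cube_def)
qed

lemma expansion_coeff:
  assumes X: "orthonormal_basis k X" and k: "k > 0" and e: "is_expansion k n X g c"
    and r: "\<rho> \<in> multi_indices k n"
  shows "c \<rho> = (\<Sum>w\<in>cube k n. g w * basis_prod n X \<rho> w) / real k ^ n"
proof -
  have "(\<Sum>w\<in>cube k n. g w * basis_prod n X \<rho> w)
      = (\<Sum>w\<in>cube k n. \<Sum>\<sigma>\<in>multi_indices k n. c \<sigma> * (basis_prod n X \<sigma> w * basis_prod n X \<rho> w))"
    using e by (intro sum.cong refl) (simp add: is_expansion_def sum_distrib_right mult.assoc)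
  also have "\<dots> = (\<Sum>\<sigma>\<in>multi_indices k n. c \<sigma> * (\<Sum>w\<in>cube k n. basis_prod n X \<sigma> w * basis_prod n X \<rho> w))"
    by (subst sum.swap) (simp add: sum_distrib_left)
  also have "\<dots> = (\<Sum>\<sigma>\<in>multi_indices k n. if \<sigma> = \<rho> then c \<rho> * real k ^ n else 0)"
    using r by (intro sum.cong refl) (simp add: basis_prod_orthonormal[OF X])
  also have "\<dots> = c \<rho> * real k ^ n" using r by (simp add: finite_multi_indices)
  finally show ?thesis using k by simp
qed

lemma ex1_expansion:
  assumes X: "orthonormal_basis k X" and k: "k > 0"
  shows "\<exists>!c. is_expansion k n X g c"
proof (rule ex_ex1I)
  define c where "c = restrict (\<lambda>\<sigma>. (\<Sum>z\<in>cube k n. g z * basis_prod n X \<sigma> z) / real k ^ n) (multi_indices k n)"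
  have "g w = (\<Sum>\<sigma>\<in>multi_indices k n. c \<sigma> * basis_prod n X \<sigma> w)" if w: "w \<in> cube k n" for w
  proof -
    have "(\<Sum>\<sigma>\<in>multi_indices k n. c \<sigma> * basis_prod n X \<sigma> w)
        = (\<Sum>\<sigma>\<in>multi_indices k n. \<Sum>z\<in>cube k n. g z / real k ^ n * (basis_prod n X \<sigma> w * basis_prod n X \<sigma> z))"
      by (intro sum.cong refl) (simp add: c_def sum_distrib_right sum_divide_distrib,
          intro sum.cong refl, simp)
    also have "\<dots> = (\<Sum>z\<in>cube k n. g z / real k ^ n * (\<Sum>\<sigma>\<in>multi_indices k n. basis_prod n X \<sigma> w * basis_prod n X \<sigma> z))"
      by (subst sum.swap) (simp add: sum_distrib_left)
    also have "\<dots> = (\<Sum>z\<in>cube k n. if w = z then g w else 0)"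
      using w k by (intro sum.cong refl) (simp add: basis_prod_complete[OF X])
    finally show ?thesis using w by (simp add: finite_cube)
  qed
  moreover have "c \<in> extensional (multi_indices k n)" by (simp add: c_def)
  ultimately show "\<exists>c. is_expansion k n X g c" unfolding is_expansion_def by blast
next
  fix c d assume c: "is_expansion k n X g c" and d: "is_expansion k n X g d"
  show "c = d"
  proof (rule extensionalityI)
    show "c \<in> extensional (multi_indices k n)" "d \<in> extensional (multi_indices k n)"
      using c d by (simp_all add: is_expansion_def)
    fix \<rho> assume "\<rho> \<in> multi_indices k n"
    then show "c \<rho> = d \<rho>"
      using expansion_coeff[OF X k c] expansion_coeff[OF X k d] by metis
  qed
qed

lemma fourier_coeff_eq:
  assumes "orthonormal_basis k X" "k > 0" "\<sigma> \<in> multi_indices k n"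
  shows "fourier_coeff k n X g \<sigma> = (\<Sum>w\<in>cube k n. g w * basis_prod n X \<sigma> w) / real k ^ n"
proof -
  have "is_expansion k n X g (fourier_coeff k n X g)"
    unfolding fourier_coeff_def by (rule theI'[OF ex1_expansion[OF assms(1,2)]])
  then show ?thesis using assms by (intro expansion_coeff)
qed

lemma prob_space_std_gaussian: "prob_space (std_gaussian d)"
  unfolding std_gaussian_def by (intro prob_space_PiM prob_space_normal_density) simp

lemma integrable_std_gaussian_coordinate:
  assumes "l \<in> {1..d}"
  shows "integrable (std_gaussian d) (\<lambda>x. x l)"
proof -
  let ?N = std_normal_distribution
  have N: "prob_space ?N" by (rule prob_space_normal_density) simp
  have d: "distr (std_gaussian d) ?N (\<lambda>x. x l) = ?N"
    unfolding std_gaussian_def using assms by (intro distr_PiM_component N) auto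
  have "integrable ?N (\<lambda>t. t)"
    using integrable_std_normal_moment[of 1] by (subst integrable_density) auto
  then have "integrable (distr (std_gaussian d) ?N (\<lambda>x. x l)) (\<lambda>t. t)" by (simp add: d)
  moreover have "(\<lambda>x. x l) \<in> measurable (std_gaussian d) ?N"
    unfolding std_gaussian_def using assms by (intro measurable_component_singleton) auto
  ultimately show ?thesis by (subst (asm) integrable_distr_eq) auto
qed

lemma gaussian_objective_nonempty: "{gaussian_objective k h | h. fractional_partition k h} \<noteq> {}"
proof -
  have "fractional_partition k (\<lambda>_ _. 0)" by (simp add: fractional_partition_def)
  then show ?thesis by blast
qed

lemma gaussian_objective_bdd_above: "bdd_above {gaussian_objective k h | h. fractional_partition k h}"
proof (rule bdd_aboveI)
  let ?G = "std_gaussian (k - 1)"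
  fix y assume "y \<in> {gaussian_objective k h | h. fractional_partition k h}"
  then obtain h where h: "fractional_partition k h" and y: "y = gaussian_objective k h" by auto
  have le: "\<bar>\<integral>x. x l * h j x \<partial>?G\<bar> \<le> (\<integral>x. \<bar>x l\<bar> \<partial>?G)" if j: "j \<in> {1..k}" and l: "l \<in> {1..k - 1}" for j l
  proof -
    have "\<bar>h j x\<bar> \<le> 1" if x: "x \<in> space ?G" for x
    proof -
      have "h j x \<le> (\<Sum>j\<in>{1..k}. h j x)"
        using h x j by (intro member_le_sum) (auto simp: fractional_partition_def)
      then show ?thesis using h x j by (fastforce simp: fractional_partition_def)
    qed
    then have "(\<integral>x. \<bar>x l * h j x\<bar> \<partial>?G) \<le> (\<integral>x. \<bar>x l\<bar> \<partial>?G)"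
      using integrable_std_gaussian_coordinate[OF l]
      by (intro integral_mono') (auto simp: abs_mult intro: mult_left_le)
    then show ?thesis by (rule order_trans[OF integral_abs_bound])
  qed
  have "y = (\<Sum>j\<in>{1..k}. \<Sum>l\<in>{1..k - 1}. (\<integral>x. x l * h j x \<partial>?G)\<^sup>2)"
    by (simp add: y gaussian_objective_def L2_set_def sum_nonneg)
  also have "\<dots> \<le> (\<Sum>j\<in>{1..k}. \<Sum>l\<in>{1..k - 1}. (\<integral>x. \<bar>x l\<bar> \<partial>?G)\<^sup>2)"
  proof (intro sum_mono)
    fix j l assume "j \<in> {1..k}" "l \<in> {1..k - 1}"
    then show "(\<integral>x. x l * h j x \<partial>?G)\<^sup>2 \<le> (\<integral>x. \<bar>x l\<bar> \<partial>?G)\<^sup>2"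
      using power_mono[OF le, of j l 2] by simp
  qed
  finally show "y \<le> (\<Sum>j\<in>{1..k}. \<Sum>l\<in>{1..k - 1}. (\<integral>x. \<bar>x l\<bar> \<partial>?G)\<^sup>2)" .
qed

end

theory Submission
  imports Defs "HOL-Real_Asymp.Real_Asymp"
begin

text \<open>
  Only the level-one part of \<open>f\<close> enters the objective. Let \<open>S i\<close> be the level-one part of \<open>f i\<close>, a
  linear form in independent vectors, so that \<open>OBJ f\<close> is the expectation of \<open>\<Sum>i. f i * S i\<close>.
  One may assume \<open>\<Sum>i. f i = 1\<close>; then \<open>OBJ f\<close> is at most the expectation of the smoothed maximum
  \<open>ln (\<Sum>i. exp (\<beta> * S i)) / \<beta>\<close>, and \<open>\<Sum>i. S i = 0\<close>, so the covariance matrix of \<open>S\<close> is also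
  that of a linear image \<open>G\<close> of a standard Gaussian vector in dimension \<open>k - 1\<close>. Since the level-one
  influences are small, interpolating along \<open>sin \<theta> * S + cos \<theta> * G\<close> shows that replacing \<open>S\<close> by \<open>G\<close>
  hardly changes this expectation. On the Gaussian side the smoothed maximum is, up to \<open>k / \<beta>\<close>, the
  sum \<open>\<Sum>i. h i * G i\<close>, where the Gibbs weights \<open>h i\<close> form a fractional partition; by the AM-GM
  inequality its expectation is at most half of \<open>OBJ f + C k\<close>.
\<close>

subsection \<open>Gaussian integration by parts\<close>

lemma integrable_dominated:
  fixes f b :: "'a \<Rightarrow> real"
  assumes "integrable M b" "f \<in> borel_measurable M" "\<And>x. \<bar>f x\<bar> \<le> b x"
  shows "integrable M f"
  by (rule Bochner_Integration.integrable_bound[OF assms(1,2)])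
    (auto intro: order_trans[OF assms(3) abs_ge_self])

abbreviation "\<N> \<equiv> std_normal_distribution"

lemma prob_space_std_normal: "prob_space \<N>"
  by (rule prob_space_normal_density) simp

lemma integral_std_normal:
  fixes f :: "real \<Rightarrow> real"
  assumes "f \<in> borel_measurable borel"
  shows "(\<integral>t. f t \<partial>\<N>) = (\<integral>t. std_normal_density t * f t \<partial>lborel)"
    and "integrable \<N> f \<longleftrightarrow> integrable lborel (\<lambda>t. std_normal_density t * f t)"
  using assms by (simp_all add: integral_density integrable_density)

lemma std_normal_density_deriv:
  "(std_normal_density has_real_derivative - (t * std_normal_density t)) (at t)"
  unfolding std_normal_density_def by (auto intro!: derivative_eq_intros simp: field_simps)

lemma std_normal_density_tendsto_0:
  "(std_normal_density \<longlongrightarrow> 0) at_top" "(std_normal_density \<longlongrightarrow> 0) at_bot"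
  unfolding std_normal_density_def by real_asymp+

text \<open>Stein's identity in one variable. The integrand of the difference, weighted by the
  density, is the derivative of \<open>std_normal_density t * \<phi> t\<close>, which vanishes at
  both infinities because \<open>\<phi>\<close> is bounded. The bounds also give the integrability
  needed to apply the fundamental theorem on the whole line.\<close>

lemma gaussian_integration_by_parts_1:
  fixes \<phi> \<phi>' :: "real \<Rightarrow> real"
  assumes deriv: "\<And>t. (\<phi> has_real_derivative \<phi>' t) (at t)" and cont: "\<And>t. isCont \<phi>' t"
    and bd: "\<And>t. \<bar>\<phi> t\<bar> \<le> B" and bd': "\<And>t. \<bar>\<phi>' t\<bar> \<le> B'"
  shows "(\<integral>t. t * \<phi> t \<partial>\<N>) = (\<integral>t. \<phi>' t \<partial>\<N>)"
proof -
  let ?n = std_normal_density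
  let ?f = "\<lambda>t. ?n t * \<phi>' t - ?n t * (t * \<phi> t)"
  have cont\<phi>: "isCont \<phi> t" for t using deriv DERIV_isCont by blast
  have contn: "isCont ?n t" for t using std_normal_density_deriv DERIV_isCont by blast
  have [measurable]: "\<phi> \<in> borel_measurable borel" "\<phi>' \<in> borel_measurable borel"
    using cont\<phi> cont by (auto intro!: borel_measurable_continuous_onI simp: continuous_on_eq_continuous_at)
  have int1: "integrable lborel (\<lambda>t. ?n t * \<phi>' t)"
  proof (rule Bochner_Integration.integrable_bound[where f = "\<lambda>t. B' * ?n t"])
    show "integrable lborel (\<lambda>t. B' * ?n t)" by simp
    show "AE t in lborel. norm (?n t * \<phi>' t) \<le> norm (B' * ?n t)"
    proof (rule AE_I2)
      fix t show "norm (?n t * \<phi>' t) \<le> norm (B' * ?n t)"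
        using mult_left_mono[OF order_trans[OF bd'[of t] abs_ge_self], of "?n t"] by (simp add: abs_mult mult.commute)
    qed
  qed simp
  have int2: "integrable lborel (\<lambda>t. ?n t * (t * \<phi> t))"
  proof (rule Bochner_Integration.integrable_bound[where f = "\<lambda>t. B * (?n t * \<bar>t\<bar> ^ 1)"])
    show "integrable lborel (\<lambda>t. B * (?n t * \<bar>t\<bar> ^ 1))"
      by (intro integrable_mult_right integrable_std_normal_moment_abs)
    show "AE t in lborel. norm (?n t * (t * \<phi> t)) \<le> norm (B * (?n t * \<bar>t\<bar> ^ 1))"
    proof (rule AE_I2)
      fix t show "norm (?n t * (t * \<phi> t)) \<le> norm (B * (?n t * \<bar>t\<bar> ^ 1))"
        using mult_left_mono[OF order_trans[OF bd[of t] abs_ge_self], of "?n t * \<bar>t\<bar>"] by (simp add: abs_mult mult_ac)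
    qed
  qed simp
  have D: "((\<lambda>t. ?n t * \<phi> t) has_vector_derivative ?f t) (at t)" for t
    unfolding has_real_derivative_iff_has_vector_derivative[symmetric]
    by (rule derivative_eq_intros deriv std_normal_density_deriv refl | simp add: algebra_simps)+
  have lim: "((\<lambda>t. ?n t * \<phi> t) \<longlongrightarrow> 0) F" if "(?n \<longlongrightarrow> 0) F" for F
    by (rule tendsto_0_le[OF that, where K = B]) (use bd in \<open>simp add: abs_mult mult_right_mono mult.commute[of B] mult_left_mono\<close>)
  have "(LBINT t=-\<infinity>..\<infinity>. ?f t) = 0 - 0"
  proof (rule interval_integral_FTC_integrable[where F = "\<lambda>t. ?n t * \<phi> t"])
    show "isCont ?f t" for t using cont\<phi> cont contn by (intro continuous_intros)
    show "set_integrable lborel (einterval (-\<infinity>) \<infinity>) ?f"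
      using int1 int2 by (simp add: einterval_eq_UNIV set_integrable_def)
    show "(((\<lambda>t. ?n t * \<phi> t) \<circ> real_of_ereal) \<longlongrightarrow> 0) (at_right (-\<infinity>))"
      using lim[OF std_normal_density_tendsto_0(2)] by (simp add: ereal_tendsto_simps)
    show "(((\<lambda>t. ?n t * \<phi> t) \<circ> real_of_ereal) \<longlongrightarrow> 0) (at_left \<infinity>)"
      using lim[OF std_normal_density_tendsto_0(1)] by (simp add: ereal_tendsto_simps)
  qed (auto intro: D)
  then have "(\<integral>t. ?f t \<partial>lborel) = 0"
    by (simp add: interval_lebesgue_integral_def einterval_eq_UNIV set_lebesgue_integral_def)
  then show ?thesis using int1 int2 by (simp add: integral_std_normal)
qed

lemma measurable_std_gaussian_component [measurable]:
  "l \<in> {1..d} \<Longrightarrow> (\<lambda>x. x l) \<in> borel_measurable (std_gaussian d)"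
  using integrable_std_gaussian_coordinate by blast

text \<open>By Fubini the coordinate \<open>l\<close> is integrated first with the others frozen,
  which reduces the claim to the one-variable identity. Boundedness of \<open>\<phi>\<close> and
  \<open>\<phi>'\<close> supplies the joint integrability.\<close>

lemma gaussian_integration_by_parts:
  fixes \<phi> \<phi>' :: "(nat \<Rightarrow> real) \<Rightarrow> real"
  assumes l: "l \<in> {1..d}"
    and meas [measurable]: "\<phi> \<in> borel_measurable (std_gaussian d)" "\<phi>' \<in> borel_measurable (std_gaussian d)"
    and deriv: "\<And>x t. ((\<lambda>s. \<phi> (x(l := s))) has_real_derivative \<phi>' (x(l := t))) (at t)"
    and cont: "\<And>x t. isCont (\<lambda>s. \<phi>' (x(l := s))) t"
    and bd: "\<And>x. \<bar>\<phi> x\<bar> \<le> B" and bd': "\<And>x. \<bar>\<phi>' x\<bar> \<le> B'"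
  shows "(\<integral>x. x l * \<phi> x \<partial>std_gaussian d) = (\<integral>x. \<phi>' x \<partial>std_gaussian d)"
proof -
  interpret G: prob_space "std_gaussian d" by (rule prob_space_std_gaussian)
  interpret product_prob_space "\<lambda>_::nat. \<N>"
    by (auto simp: product_prob_space_def product_prob_space_axioms_def product_sigma_finite_def
        prob_space_std_normal prob_space_imp_sigma_finite)
  let ?I = "{1..d} - {l}"
  have I: "{1..d} = insert l ?I" using l by auto
  have G: "std_gaussian d = PiM (insert l ?I) (\<lambda>_. \<N>)" unfolding std_gaussian_def using I by simp
  have int: "integrable (std_gaussian d) (\<lambda>x. x l * \<phi> x)"
  proof (rule Bochner_Integration.integrable_bound[where f = "\<lambda>x. B * x l"])
    show "integrable (std_gaussian d) (\<lambda>x. B * x l)"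
      using integrable_std_gaussian_coordinate[OF l] by simp
    show "AE x in std_gaussian d. norm (x l * \<phi> x) \<le> norm (B * x l)"
    proof (rule AE_I2)
      fix x show "norm (x l * \<phi> x) \<le> norm (B * x l)"
        using mult_left_mono[OF order_trans[OF bd[of x] abs_ge_self], of "\<bar>x l\<bar>"] by (simp add: abs_mult mult_ac)
    qed
  qed (use l in simp)
  have int': "integrable (std_gaussian d) \<phi>'"
    using bd' by (intro G.integrable_const_bound[where B = B']) auto
  have "(\<integral>x. x l * \<phi> x \<partial>std_gaussian d) = (\<integral>x. (\<integral>t. t * \<phi> (x(l := t)) \<partial>\<N>) \<partial>PiM ?I (\<lambda>_. \<N>))"
    using int unfolding G by (subst product_integral_insert) auto
  also have "\<dots> = (\<integral>x. (\<integral>t. \<phi>' (x(l := t)) \<partial>\<N>) \<partial>PiM ?I (\<lambda>_. \<N>))"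
    using bd bd' by (intro Bochner_Integration.integral_cong refl gaussian_integration_by_parts_1 deriv cont)
  also have "\<dots> = (\<integral>x. \<phi>' x \<partial>std_gaussian d)"
    using int' unfolding G by (subst product_integral_insert) auto
  finally show ?thesis .
qed

text \<open>Dominated convergence along an arbitrary null sequence of increments. The mean value
  inequality turns the bound on \<open>f'\<close>, uniform in the parameter, into a bound on the
  difference quotients.\<close>

lemma has_real_derivative_integral:
  fixes f f' :: "real \<Rightarrow> 'a \<Rightarrow> real"
  assumes deriv: "\<And>x s. x \<in> space M \<Longrightarrow> ((\<lambda>s. f s x) has_real_derivative f' s x) (at s)"
    and int: "\<And>s. integrable M (f s)" and meas: "f' t \<in> borel_measurable M"
    and bd: "\<And>x s. x \<in> space M \<Longrightarrow> \<bar>f' s x\<bar> \<le> B x" and B: "integrable M B"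
  shows "((\<lambda>s. \<integral>x. f s x \<partial>M) has_real_derivative (\<integral>x. f' t x \<partial>M)) (at t)"
  unfolding DERIV_def tendsto_at_iff_sequentially
proof (intro allI impI)
  fix h :: "nat \<Rightarrow> real" assume h: "\<forall>i. h i \<in> UNIV - {0}" and lim: "h \<longlonglongrightarrow> 0"
  let ?q = "\<lambda>i x. (f (t + h i) x - f t x) / h i"
  have "(\<lambda>i. \<integral>x. ?q i x \<partial>M) \<longlonglongrightarrow> (\<integral>x. f' t x \<partial>M)"
  proof (rule integral_dominated_convergence[OF meas _ B])
    show "?q i \<in> borel_measurable M" for i
      using int[THEN borel_measurable_integrable] by measurable
    show "AE x in M. (\<lambda>i. ?q i x) \<longlonglongrightarrow> f' t x"
    proof (rule AE_I2)
      fix x assume "x \<in> space M"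
      then have "(\<lambda>h. (f (t + h) x - f t x) / h) \<midarrow>0\<rightarrow> f' t x"
        using deriv unfolding DERIV_def by blast
      then show "(\<lambda>i. ?q i x) \<longlonglongrightarrow> f' t x"
        using h lim unfolding tendsto_at_iff_sequentially comp_def by blast
    qed
    show "AE x in M. norm (?q i x) \<le> B x" for i
    proof (rule AE_I2)
      fix x assume x: "x \<in> space M"
      have "norm (f (t + h i) x - f t x) \<le> B x * norm (t + h i - t)"
        by (rule field_differentiable_bound[where S = UNIV, OF _ deriv]) (use x bd in auto)
      then show "norm (?q i x) \<le> B x"
        using h by (simp add: abs_divide pos_divide_le_eq)
    qed
  qed
  moreover have "(\<integral>x. ?q i x \<partial>M) = ((\<integral>x. f (t + h i) x \<partial>M) - (\<integral>x. f t x \<partial>M)) / h i" for i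
    using int by simp
  ultimately show "((\<lambda>h. ((\<integral>x. f (t + h) x \<partial>M) - (\<integral>x. f t x \<partial>M)) / h) \<circ> h) \<longlonglongrightarrow> (\<integral>x. f' t x \<partial>M)"
    by (simp only: comp_def)
qed

subsection \<open>Gibbs averages and the smoothed maximum\<close>

locale gibbs =
  fixes K :: "'a set" and \<beta> :: real
  assumes finite_K: "finite K" and K_nonempty: "K \<noteq> {}" and \<beta>_pos: "\<beta> > 0"
begin

definition partition_sum :: "('a \<Rightarrow> real) \<Rightarrow> real" where
  "partition_sum y = (\<Sum>i\<in>K. exp (\<beta> * y i))"

text \<open>Expectation of \<open>d\<close> under the Gibbs measure on \<open>K\<close>, whose
  weights are proportional to \<open>exp (\<beta> * y i)\<close>.\<close>

definition mean :: "('a \<Rightarrow> real) \<Rightarrow> ('a \<Rightarrow> real) \<Rightarrow> real" where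
  "mean y d = (\<Sum>i\<in>K. exp (\<beta> * y i) * d i) / partition_sum y"

definition cov :: "('a \<Rightarrow> real) \<Rightarrow> ('a \<Rightarrow> real) \<Rightarrow> ('a \<Rightarrow> real) \<Rightarrow> real" where
  "cov y d e = mean y (\<lambda>i. d i * e i) - mean y d * mean y e"

text \<open>Log-sum-exp, a smooth substitute for the maximum over \<open>K\<close>: it exceeds the
  maximum by at most \<open>ln (card K) / \<beta>\<close>, and its gradient is the vector of Gibbs
  weights.\<close>

definition lse :: "('a \<Rightarrow> real) \<Rightarrow> real" where
  "lse y = ln (partition_sum y) / \<beta>"

lemma partition_sum_pos: "partition_sum y > 0"
  unfolding partition_sum_def using finite_K K_nonempty by (intro sum_pos) auto

lemma mean_abs_le:
  assumes "\<And>i. i \<in> K \<Longrightarrow> \<bar>d i\<bar> \<le> M"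
  shows "\<bar>mean y d\<bar> \<le> M"
proof -
  have "\<bar>\<Sum>i\<in>K. exp (\<beta> * y i) * d i\<bar> \<le> (\<Sum>i\<in>K. \<bar>exp (\<beta> * y i) * d i\<bar>)" by (rule sum_abs)
  also have "\<dots> \<le> (\<Sum>i\<in>K. exp (\<beta> * y i) * M)"
    using assms by (intro sum_mono) (simp add: abs_mult)
  also have "\<dots> = M * partition_sum y" by (simp add: partition_sum_def sum_distrib_left mult.commute)
  finally show ?thesis using partition_sum_pos[of y] by (simp add: mean_def abs_divide pos_divide_le_eq)
qed

lemma mean_add: "mean y (\<lambda>i. d i + e i) = mean y d + mean y e"
  by (simp add: mean_def sum.distrib distrib_left add_divide_distrib)

lemma mean_cmult: "mean y (\<lambda>i. c * d i) = c * mean y d"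
  by (simp add: mean_def sum_distrib_left mult.left_commute)

lemma mean_sum: "mean y (\<lambda>i. \<Sum>a\<in>A. d a i) = (\<Sum>a\<in>A. mean y (d a))"
  unfolding mean_def by (simp add: sum_distrib_left sum_divide_distrib, subst sum.swap) simp

lemma cov_abs_le:
  assumes "\<And>i. i \<in> K \<Longrightarrow> \<bar>d i\<bar> \<le> M" "\<And>i. i \<in> K \<Longrightarrow> \<bar>e i\<bar> \<le> N"
  shows "\<bar>cov y d e\<bar> \<le> 2 * (M * N)"
proof -
  obtain i0 where "i0 \<in> K" using K_nonempty by auto
  then have M: "0 \<le> M" and N: "0 \<le> N" using assms by (auto intro: order_trans[OF abs_ge_zero])
  have "\<bar>mean y (\<lambda>i. d i * e i)\<bar> \<le> M * N"
    using assms M by (intro mean_abs_le) (simp add: abs_mult mult_mono)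
  moreover have "\<bar>mean y d * mean y e\<bar> \<le> M * N"
    unfolding abs_mult using M N by (intro mult_mono mean_abs_le assms) auto
  ultimately show ?thesis unfolding cov_def by linarith
qed

lemma partition_sum_deriv:
  assumes "\<And>i. i \<in> K \<Longrightarrow> ((\<lambda>t. y t i) has_real_derivative d i) (at t)"
  shows "((\<lambda>t. partition_sum (y t)) has_real_derivative \<beta> * (\<Sum>i\<in>K. exp (\<beta> * y t i) * d i)) (at t)"
proof -
  have "((\<lambda>t. exp (\<beta> * y t i)) has_real_derivative \<beta> * (exp (\<beta> * y t i) * d i)) (at t)" if "i \<in> K" for i
    by (rule derivative_eq_intros assms that refl | simp)+
  then show ?thesis unfolding partition_sum_def sum_distrib_left
    by (rule DERIV_sum)
qed

lemma lse_deriv: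
  assumes "\<And>i. i \<in> K \<Longrightarrow> ((\<lambda>t. y t i) has_real_derivative d i) (at t)"
  shows "((\<lambda>t. lse (y t)) has_real_derivative mean (y t) d) (at t)"
  unfolding lse_def mean_def using partition_sum_pos[of "y t"] \<beta>_pos
  by (auto intro!: derivative_eq_intros partition_sum_deriv[OF assms] simp: field_simps)

text \<open>Quotient rule. Together with \<open>lse_deriv\<close> it identifies
  \<open>\<beta> * cov\<close> as the second derivative of \<open>lse\<close>, the quantity that has
  to match between the discrete and the Gaussian side.\<close>

lemma mean_deriv:
  assumes "\<And>i. i \<in> K \<Longrightarrow> ((\<lambda>t. y t i) has_real_derivative e i) (at t)"
  shows "((\<lambda>t. mean (y t) d) has_real_derivative \<beta> * cov (y t) d e) (at t)"
proof -
  let ?E = "\<lambda>i. exp (\<beta> * y t i)"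
  have "((\<lambda>t. exp (\<beta> * y t i) * d i) has_real_derivative \<beta> * (?E i * (d i * e i))) (at t)" if "i \<in> K" for i
    by (rule derivative_eq_intros assms that refl | simp)+
  then have "((\<lambda>t. \<Sum>i\<in>K. exp (\<beta> * y t i) * d i) has_real_derivative \<beta> * (\<Sum>i\<in>K. ?E i * (d i * e i))) (at t)"
    unfolding sum_distrib_left by (rule DERIV_sum)
  from DERIV_divide[OF this partition_sum_deriv[OF assms]] show ?thesis
    unfolding cov_def mean_def using partition_sum_pos[of "y t"] by (simp add: field_simps)
qed

section \<open>Stability of Gibbs means and covariances under perturbation\<close>

lemma mean_lipschitz:
  assumes "\<And>i. i \<in> K \<Longrightarrow> \<bar>d i\<bar> \<le> M" "\<And>i. i \<in> K \<Longrightarrow> \<bar>e i\<bar> \<le> N"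
  shows "\<bar>mean (\<lambda>i. y i + e i) d - mean y d\<bar> \<le> 2 * \<beta> * (M * N)"
proof -
  have D: "((\<lambda>t. mean (\<lambda>i. y i + t * e i) d) has_real_derivative \<beta> * cov (\<lambda>i. y i + t * e i) d e) (at t)" for t
    by (rule mean_deriv) (auto intro!: derivative_eq_intros)
  obtain t :: real where "mean (\<lambda>i. y i + 1 * e i) d - mean (\<lambda>i. y i + 0 * e i) d
      = (1 - 0) * (\<beta> * cov (\<lambda>i. y i + t * e i) d e)"
    using MVT2[of 0 1 "\<lambda>t. mean (\<lambda>i. y i + t * e i) d", OF _ D] by auto
  moreover have "\<bar>cov (\<lambda>i. y i + t * e i) d e\<bar> \<le> 2 * (M * N)"
    by (rule cov_abs_le[OF assms])
  ultimately show ?thesis using \<beta>_pos by (simp add: abs_mult mult.assoc mult.left_commute)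
qed

text \<open>The covariance contains three means. Changing them one at a time costs
  \<open>2 * \<beta> * (M * N * L)\<close> each, by \<open>mean_lipschitz\<close>.\<close>

lemma cov_lipschitz:
  assumes d: "\<And>i. i \<in> K \<Longrightarrow> \<bar>d i\<bar> \<le> M" and e: "\<And>i. i \<in> K \<Longrightarrow> \<bar>e i\<bar> \<le> N"
    and e': "\<And>i. i \<in> K \<Longrightarrow> \<bar>e' i\<bar> \<le> L"
  shows "\<bar>cov (\<lambda>i. y i + e' i) d e - cov y d e\<bar> \<le> 6 * \<beta> * (M * N * L)"
proof -
  let ?z = "\<lambda>i. y i + e' i"
  obtain i0 where "i0 \<in> K" using K_nonempty by auto
  then have M: "0 \<le> M" and N: "0 \<le> N" using assms by (auto intro: order_trans[OF abs_ge_zero])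
  have 1: "\<bar>mean ?z (\<lambda>i. d i * e i) - mean y (\<lambda>i. d i * e i)\<bar> \<le> 2 * \<beta> * (M * N * L)"
    using assms M by (intro mean_lipschitz) (simp_all add: abs_mult mult_mono)
  have "\<bar>(mean ?z d - mean y d) * mean ?z e\<bar> \<le> 2 * \<beta> * (M * L) * N"
    unfolding abs_mult using N order_trans[OF abs_ge_zero mean_lipschitz[OF d e']]
    by (intro mult_mono mean_lipschitz mean_abs_le assms) auto
  moreover have "\<bar>mean y d * (mean ?z e - mean y e)\<bar> \<le> M * (2 * \<beta> * (N * L))"
    unfolding abs_mult using M by (intro mult_mono mean_lipschitz mean_abs_le assms) auto
  moreover have "mean ?z d * mean ?z e - mean y d * mean y e
      = (mean ?z d - mean y d) * mean ?z e + mean y d * (mean ?z e - mean y e)"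
    by (simp add: algebra_simps)
  ultimately show ?thesis using 1 unfolding cov_def by (simp add: algebra_simps)
qed

text \<open>The mean value theorem yields the covariance at an intermediate point of the segment;
  \<open>cov_lipschitz\<close> moves it back to \<open>y\<close>. When \<open>d\<close> and
  \<open>e\<close> are of the same size, the error is of third order in that size.\<close>

lemma mean_taylor:
  assumes d: "\<And>i. i \<in> K \<Longrightarrow> \<bar>d i\<bar> \<le> M" and e: "\<And>i. i \<in> K \<Longrightarrow> \<bar>e i\<bar> \<le> N"
  shows "\<bar>mean (\<lambda>i. y i + e i) d - mean y d - \<beta> * cov y d e\<bar> \<le> 6 * \<beta>\<^sup>2 * (M * N * N)"
proof -
  have D: "((\<lambda>t. mean (\<lambda>i. y i + t * e i) d) has_real_derivative \<beta> * cov (\<lambda>i. y i + t * e i) d e) (at t)" for t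
    by (rule mean_deriv) (auto intro!: derivative_eq_intros)
  obtain t :: real where t: "0 < t" "t < 1"
    and eq: "mean (\<lambda>i. y i + 1 * e i) d - mean (\<lambda>i. y i + 0 * e i) d
      = (1 - 0) * (\<beta> * cov (\<lambda>i. y i + t * e i) d e)"
    using MVT2[of 0 1 "\<lambda>t. mean (\<lambda>i. y i + t * e i) d", OF _ D] by auto
  have "\<bar>t * e i\<bar> \<le> N" if "i \<in> K" for i
    using t e[OF that] by (simp add: abs_mult) (meson abs_ge_zero less_imp_le mult_left_le_one_le order_trans)
  then have "\<bar>cov (\<lambda>i. y i + t * e i) d e - cov y d e\<bar> \<le> 6 * \<beta> * (M * N * N)"
    by (intro cov_lipschitz d e)
  then have "\<beta> * \<bar>cov (\<lambda>i. y i + t * e i) d e - cov y d e\<bar> \<le> \<beta> * (6 * \<beta> * (M * N * N))"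
    using \<beta>_pos by (intro mult_left_mono) auto
  moreover have "mean (\<lambda>i. y i + e i) d - mean y d - \<beta> * cov y d e
     = \<beta> * (cov (\<lambda>i. y i + t * e i) d e - cov y d e)" using eq by (simp add: algebra_simps)
  ultimately show ?thesis using \<beta>_pos by (simp add: abs_mult power2_eq_square mult.assoc mult.left_commute)
qed

lemma le_lse: "i \<in> K \<Longrightarrow> y i \<le> lse y"
proof -
  assume i: "i \<in> K"
  have "exp (\<beta> * y i) \<le> partition_sum y"
    unfolding partition_sum_def using finite_K i by (intro member_le_sum) auto
  then have "\<beta> * y i \<le> ln (partition_sum y)" using partition_sum_pos by (simp add: ln_ge_iff)
  then show ?thesis using \<beta>_pos by (simp add: lse_def pos_le_divide_eq mult.commute)
qed

text \<open>The gap is the entropy of the Gibbs weights \<open>p\<close>; it is estimated by \<open>- p * ln p \<le> 1 - p\<close>.\<close>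
lemma lse_le_mean: "lse y \<le> mean y y + card K / \<beta>"
proof -
  let ?Z = "partition_sum y" and ?E = "\<lambda>i. exp (\<beta> * y i)"
  have "?E i * (\<beta> * lse y - \<beta> * y i) \<le> ?Z" for i
  proof -
    have "\<beta> * lse y - \<beta> * y i = ln (?Z / ?E i)"
      using partition_sum_pos[of y] \<beta>_pos by (simp add: lse_def ln_div)
    also have "\<dots> \<le> ?Z / ?E i"
      using partition_sum_pos[of y] ln_le_minus_one[of "?Z / ?E i"] by simp
    finally have "?E i * (\<beta> * lse y - \<beta> * y i) \<le> ?E i * (?Z / ?E i)" by (intro mult_left_mono) auto
    then show ?thesis by simp
  qed
  then have "(\<Sum>i\<in>K. ?E i * (\<beta> * lse y - \<beta> * y i)) \<le> (\<Sum>i\<in>K. ?Z)" by (rule sum_mono)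
  moreover have "(\<Sum>i\<in>K. ?E i * (\<beta> * lse y - \<beta> * y i)) = \<beta> * (lse y - mean y y) * ?Z"
    using partition_sum_pos[of y]
    by (simp add: mean_def partition_sum_def[symmetric] right_diff_distrib sum_subtractf sum_distrib_left[symmetric]
        sum_distrib_right[symmetric] mult.left_commute[of _ \<beta>]) (simp add: algebra_simps)
  ultimately have "\<beta> * (lse y - mean y y) * ?Z \<le> card K * ?Z" by simp
  then have "\<beta> * (lse y - mean y y) \<le> card K" using partition_sum_pos[of y] by simp
  then show ?thesis using \<beta>_pos by (simp add: field_simps)
qed

lemma abs_lse_le:
  assumes "\<And>i. i \<in> K \<Longrightarrow> \<bar>y i\<bar> \<le> M"
  shows "\<bar>lse y\<bar> \<le> M + card K / \<beta>"
proof -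
  obtain i where i: "i \<in> K" using K_nonempty by auto
  have "0 \<le> real (card K) / \<beta>" using \<beta>_pos by simp
  then show ?thesis
    using le_lse[OF i, of y] assms[OF i] lse_le_mean[of y] mean_abs_le[of y M y, OF assms] by linarith
qed

end

subsection \<open>Averages over the discrete cube\<close>

text \<open>Exchanging the \<open>j\<close>-th coordinate of \<open>w\<close> with the fresh value
  \<open>u\<close> is an involution of \<open>cube k n \<times> omega k\<close>, so it preserves
  sums.\<close>

lemma sum_cube_resample:
  assumes j: "j \<in> {1..n}"
  shows "(\<Sum>w\<in>cube k n. \<Sum>u\<in>omega k. H (w(j := u))) = real k * (\<Sum>w\<in>cube k n. (H w :: real))"
proof -
  have "(\<Sum>w\<in>cube k n. \<Sum>u\<in>omega k. H (w(j := u))) = (\<Sum>(w, u)\<in>cube k n \<times> omega k. H (w(j := u)))"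
    by (simp add: sum.cartesian_product)
  also have "\<dots> = (\<Sum>(w, u)\<in>cube k n \<times> omega k. H w)"
    by (rule sum.reindex_bij_witness[where i = "\<lambda>(w, u). (w(j := u), w j)" and j = "\<lambda>(w, u). (w(j := u), w j)"])
      (use j in \<open>auto simp: cube_def PiE_iff extensional_def\<close>)
  also have "\<dots> = real k * (\<Sum>w\<in>cube k n. H w)"
    by (simp add: sum.cartesian_product[symmetric] omega_def sum_distrib_left)
  finally show ?thesis .
qed

lemma card_cube: "card (cube k n) = k ^ n"
  by (simp add: cube_def omega_def card_PiE)

lemma card_omega: "card (omega k) = k"
  by (simp add: omega_def)

definition cube_avg :: "nat \<Rightarrow> nat \<Rightarrow> ((nat \<Rightarrow> nat) \<Rightarrow> real) \<Rightarrow> real" where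
  "cube_avg k n H = (\<Sum>w\<in>cube k n. H w) / real k ^ n"

lemma cube_avg_abs_le:
  assumes "k > 0" "\<And>w. w \<in> cube k n \<Longrightarrow> \<bar>H w\<bar> \<le> M"
  shows "\<bar>cube_avg k n H\<bar> \<le> M"
proof -
  have "\<bar>\<Sum>w\<in>cube k n. H w\<bar> \<le> real (card (cube k n)) * M"
    using assms(2) by (intro order_trans[OF sum_abs] sum_bounded_above) auto
  then show ?thesis using assms(1) by (simp add: cube_avg_def card_cube pos_divide_le_eq mult.commute)
qed

lemma cube_avg_resample:
  assumes "j \<in> {1..n}" "k > 0"
  shows "cube_avg k n H = cube_avg k n (\<lambda>w. (\<Sum>u\<in>omega k. H (w(j := u))) / real k)"
  using assms(2) unfolding cube_avg_def sum_divide_distrib[symmetric] sum_cube_resample[OF assms(1)] by simp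

lemma cube_avg_sum: "cube_avg k n (\<lambda>w. \<Sum>a\<in>A. H a w) = (\<Sum>a\<in>A. cube_avg k n (H a))"
  unfolding cube_avg_def by (subst sum.swap) (simp add: sum_divide_distrib)

lemma cube_avg_diff: "cube_avg k n (\<lambda>w. H w - H' w) = cube_avg k n H - cube_avg k n H'"
  by (simp add: cube_avg_def sum_subtractf diff_divide_distrib)

lemma cube_avg_cmult: "cube_avg k n (\<lambda>w. c * H w) = c * cube_avg k n H"
  by (simp add: cube_avg_def sum_distrib_left)

lemma cube_avg_cong: "(\<And>w. w \<in> cube k n \<Longrightarrow> H w = H' w) \<Longrightarrow> cube_avg k n H = cube_avg k n H'"
  by (simp add: cube_avg_def)

lemma cube_avg_mono: "(\<And>w. w \<in> cube k n \<Longrightarrow> H w \<le> H' w) \<Longrightarrow> cube_avg k n H \<le> cube_avg k n H'"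
  by (simp add: cube_avg_def sum_mono divide_right_mono)

lemma cube_avg_integral:
  assumes "\<And>w. w \<in> cube k n \<Longrightarrow> integrable M (H w)"
  shows "cube_avg k n (\<lambda>w. \<integral>x. H w x \<partial>M) = (\<integral>x. cube_avg k n (\<lambda>w. H w x) \<partial>M)"
    and "integrable M (\<lambda>x. cube_avg k n (\<lambda>w. H w x))"
  unfolding cube_avg_def using assms by auto

section \<open>Sums of covariances and discrete integration by parts\<close>

context gibbs begin

lemma cov_cmult: "cov y d (\<lambda>i. c * e i) = c * cov y d e"
  unfolding cov_def using mean_cmult[of y c "\<lambda>i. d i * e i"] by (simp add: mean_cmult mult.left_commute algebra_simps)

text \<open>The point of the expansion is that the right-hand side depends on the family
  \<open>d\<close> only through its Gram matrix.\<close>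

lemma sum_cov:
  "(\<Sum>a\<in>A. cov y (d a) (d a)) =
    (\<Sum>i\<in>K. exp (\<beta> * y i) * (\<Sum>a\<in>A. d a i * d a i)) / partition_sum y
    - (\<Sum>i\<in>K. \<Sum>m\<in>K. exp (\<beta> * y i) * exp (\<beta> * y m) * (\<Sum>a\<in>A. d a i * d a m)) / (partition_sum y)\<^sup>2"
proof -
  have "mean y e * mean y e = (\<Sum>i\<in>K. \<Sum>m\<in>K. exp (\<beta> * y i) * exp (\<beta> * y m) * (e i * e m)) / (partition_sum y)\<^sup>2" for e
    by (simp add: mean_def sum_product power2_eq_square mult_ac)
  then have "(\<Sum>a\<in>A. cov y (d a) (d a)) =
      (\<Sum>a\<in>A. \<Sum>i\<in>K. exp (\<beta> * y i) * (d a i * d a i)) / partition_sum y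
      - (\<Sum>a\<in>A. \<Sum>i\<in>K. \<Sum>m\<in>K. exp (\<beta> * y i) * exp (\<beta> * y m) * (d a i * d a m)) / (partition_sum y)\<^sup>2"
    by (simp add: cov_def mean_def sum_subtractf sum_divide_distrib)
  also have "(\<Sum>a\<in>A. \<Sum>i\<in>K. exp (\<beta> * y i) * (d a i * d a i)) = (\<Sum>i\<in>K. exp (\<beta> * y i) * (\<Sum>a\<in>A. d a i * d a i))"
    by (subst sum.swap) (simp add: sum_distrib_left)
  also have "(\<Sum>a\<in>A. \<Sum>i\<in>K. \<Sum>m\<in>K. exp (\<beta> * y i) * exp (\<beta> * y m) * (d a i * d a m))
      = (\<Sum>i\<in>K. \<Sum>m\<in>K. exp (\<beta> * y i) * exp (\<beta> * y m) * (\<Sum>a\<in>A. d a i * d a m))"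
    by (subst sum.swap, intro sum.cong refl, subst sum.swap) (simp add: sum_distrib_left)
  finally show ?thesis .
qed

text \<open>This is how equality of covariance matrices enters the proof: families with proportional
  Gram matrices have proportional sums of Gibbs covariances, at every point
  \<open>y\<close>.\<close>

lemma sum_cov_cong:
  assumes "\<And>i m. i \<in> K \<Longrightarrow> m \<in> K \<Longrightarrow> (\<Sum>a\<in>A. d a i * d a m) = c * (\<Sum>b\<in>B. e b i * e b m)"
  shows "(\<Sum>a\<in>A. cov y (d a) (d a)) = c * (\<Sum>b\<in>B. cov y (e b) (e b))"
  unfolding sum_cov using assms
  by (simp add: right_diff_distrib sum_distrib_left mult_ac cong: sum.cong)

text \<open>A discrete counterpart of Gaussian integration by parts: expand around the configuration with
  the \<open>j\<close>-th summand removed, which is independent of that summand.\<close>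
lemma discrete_integration_by_parts:
  fixes \<xi> :: "nat \<Rightarrow> nat \<Rightarrow> 'a \<Rightarrow> real" and c :: "'a \<Rightarrow> real" and s :: real and n :: nat
  defines "Z \<equiv> \<lambda>w i. c i + s * (\<Sum>j\<in>{1..n}. \<xi> j (w j) i)"
  assumes k: "k > 0" and j: "j \<in> {1..n}" and s: "\<bar>s\<bar> \<le> 1"
    and centred: "\<And>i. i \<in> K \<Longrightarrow> (\<Sum>u\<in>omega k. \<xi> j u i) = 0"
    and bd: "\<And>u i. u \<in> omega k \<Longrightarrow> i \<in> K \<Longrightarrow> \<bar>\<xi> j u i\<bar> \<le> D"
  shows "\<bar>cube_avg k n (\<lambda>w. mean (Z w) (\<xi> j (w j)))
      - s * \<beta> * cube_avg k n (\<lambda>w. (\<Sum>u\<in>omega k. cov (Z w) (\<xi> j u) (\<xi> j u)) / real k)\<bar> \<le> 12 * \<beta>\<^sup>2 * D ^ 3"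
proof -
  let ?V = "\<lambda>y. (\<Sum>u\<in>omega k. cov y (\<xi> j u) (\<xi> j u)) / real k"
  let ?H = "\<lambda>w. mean (Z w) (\<xi> j (w j)) - s * \<beta> * ?V (Z w)"
  have s1: "\<bar>s * \<xi> j u i\<bar> \<le> D" if "u \<in> omega k" "i \<in> K" for u i
    using bd[OF that] s mult_mono[of "\<bar>s\<bar>" 1 "\<bar>\<xi> j u i\<bar>" D] by (simp add: abs_mult)
  have D3: "D * D * D = D ^ 3" by (simp add: power3_eq_cube)
  have "\<bar>cube_avg k n ?H\<bar> \<le> 12 * \<beta>\<^sup>2 * D ^ 3"
    unfolding cube_avg_resample[OF j k, of ?H]
  proof (rule cube_avg_abs_le[OF k])
    fix w assume w: "w \<in> cube k n"
    define b where "b = (\<lambda>i. c i + s * (\<Sum>j'\<in>{1..n} - {j}. \<xi> j' (w j') i))"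
    have Z: "Z (w(j := u)) = (\<lambda>i. b i + s * \<xi> j u i)" for u
    proof
      fix i
      have "(\<Sum>j'\<in>{1..n}. \<xi> j' ((w(j := u)) j') i) = \<xi> j u i + (\<Sum>j'\<in>{1..n} - {j}. \<xi> j' (w j') i)"
        using j by (subst sum.remove[of _ j]) auto
      then show "Z (w(j := u)) i = b i + s * \<xi> j u i"
        unfolding Z_def b_def by (simp add: algebra_simps)
    qed
    \<comment> \<open>First error: Taylor expansion at \<open>b\<close> in the direction of the
      \<open>j\<close>-th summand.\<close>
    have 1: "\<bar>mean (Z (w(j := u))) (\<xi> j u) - mean b (\<xi> j u) - s * \<beta> * cov b (\<xi> j u) (\<xi> j u)\<bar> \<le> 6 * \<beta>\<^sup>2 * D ^ 3"
      if u: "u \<in> omega k" for u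
      using mean_taylor[of "\<xi> j u" D "\<lambda>i. s * \<xi> j u i" D b] bd[OF u] s1[OF u]
      by (simp add: Z power3_eq_cube cov_cmult mult_ac)
    \<comment> \<open>Second error: the statement evaluates the covariances at the full
      configuration, the expansion at \<open>b\<close>. The two errors add up to the constant
      12.\<close>
    have 2: "\<bar>s * \<beta> * (?V (Z (w(j := u))) - ?V b)\<bar> \<le> 6 * \<beta>\<^sup>2 * D ^ 3" if u: "u \<in> omega k" for u
    proof -
      have "\<bar>?V (Z (w(j := u))) - ?V b\<bar>
          = \<bar>\<Sum>v\<in>omega k. cov (\<lambda>i. b i + s * \<xi> j u i) (\<xi> j v) (\<xi> j v) - cov b (\<xi> j v) (\<xi> j v)\<bar> / real k"
        using k by (simp add: Z sum_subtractf diff_divide_distrib[symmetric])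
      also have "\<dots> \<le> (real (card (omega k)) * (6 * \<beta> * (D * D * D))) / real k"
        by (intro divide_right_mono order_trans[OF sum_abs] sum_bounded_above cov_lipschitz bd s1[OF u]) auto
      also have "\<dots> = 6 * \<beta> * D ^ 3" using k by (simp add: card_omega D3)
      finally have "\<bar>s\<bar> * \<bar>?V (Z (w(j := u))) - ?V b\<bar> \<le> 1 * (6 * \<beta> * D ^ 3)"
        using s by (intro mult_mono) auto
      from mult_left_mono[OF this, of \<beta>] show ?thesis
        using \<beta>_pos by (simp add: abs_mult power2_eq_square mult_ac)
    qed
    have "(\<Sum>u\<in>omega k. ?H (w(j := u)))
        = (\<Sum>u\<in>omega k. (mean (Z (w(j := u))) (\<xi> j u) - mean b (\<xi> j u) - s * \<beta> * cov b (\<xi> j u) (\<xi> j u))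
            - s * \<beta> * (?V (Z (w(j := u))) - ?V b))"
    proof -
      \<comment> \<open>The zeroth-order term disappears: \<open>b\<close> does not depend on
        \<open>u\<close>, so averaging over \<open>u\<close> acts inside the mean, where the summand
        is centred.\<close>
      have "(\<Sum>u\<in>omega k. mean b (\<xi> j u)) = mean b (\<lambda>i. \<Sum>u\<in>omega k. \<xi> j u i)" by (simp add: mean_sum)
      also have "\<dots> = 0" using centred by (simp add: mean_def)
      finally have "(\<Sum>u\<in>omega k. mean b (\<xi> j u)) = 0" .
      moreover have "(\<Sum>u\<in>omega k. s * \<beta> * cov b (\<xi> j u) (\<xi> j u)) = (\<Sum>u\<in>omega k. s * \<beta> * ?V b)"
        using k by (simp add: card_omega sum_distrib_left[symmetric])
      ultimately show ?thesis
        by (simp add: sum_subtractf right_diff_distrib)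
    qed
    also have "\<bar>\<dots>\<bar> \<le> real (card (omega k)) * (12 * \<beta>\<^sup>2 * D ^ 3)"
    proof (intro order_trans[OF sum_abs] sum_bounded_above)
      fix u assume u: "u \<in> omega k"
      have "6 * \<beta>\<^sup>2 * D ^ 3 + 6 * \<beta>\<^sup>2 * D ^ 3 = 12 * \<beta>\<^sup>2 * D ^ 3" by simp
      then show "\<bar>mean (Z (w(j := u))) (\<xi> j u) - mean b (\<xi> j u) - s * \<beta> * cov b (\<xi> j u) (\<xi> j u)
            - s * \<beta> * (?V (Z (w(j := u))) - ?V b)\<bar> \<le> 12 * \<beta>\<^sup>2 * D ^ 3"
        using order_trans[OF abs_triangle_ineq4 add_mono[OF 1[OF u] 2[OF u]]] by (simp only:)
    qed
    finally show "\<bar>(\<Sum>u\<in>omega k. ?H (w(j := u))) / real k\<bar> \<le> 12 * \<beta>\<^sup>2 * D ^ 3"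
      using k by (simp add: card_omega pos_divide_le_eq mult.commute)
  qed
  then show ?thesis by (simp only: cube_avg_diff cube_avg_cmult)
qed

end

subsection \<open>The invariance principle for linear forms\<close>

context gibbs begin

lemma cov_deriv_isCont:
  assumes "\<And>i. i \<in> K \<Longrightarrow> ((\<lambda>t. y t i) has_real_derivative e' i) (at t)"
  shows "isCont (\<lambda>t. cov (y t) d e) t"
  unfolding cov_def using mean_deriv[OF assms, THEN DERIV_isCont] by (intro continuous_intros) auto

lemma measurable_gibbs:
  assumes "\<And>i. i \<in> K \<Longrightarrow> (\<lambda>x. y x i) \<in> borel_measurable M" "\<And>i. i \<in> K \<Longrightarrow> (\<lambda>x. d x i) \<in> borel_measurable M"
  shows "(\<lambda>x. lse (y x)) \<in> borel_measurable M" "(\<lambda>x. mean (y x) (d x)) \<in> borel_measurable M"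
    "(\<lambda>x. cov (y x) (d x) (d x)) \<in> borel_measurable M"
  unfolding lse_def cov_def mean_def partition_sum_def using assms by measurable

text \<open>The Gibbs mean is linear in its last argument, so \<open>G x\<close> splits into the
  terms \<open>x l * mean _ (W l)\<close>. Gaussian integration by parts applies to each of them,
  since the configuration is affine in coordinate \<open>l\<close> with slope
  \<open>c * W l\<close>.\<close>

lemma gaussian_mean:
  fixes W :: "nat \<Rightarrow> 'a \<Rightarrow> real" and d :: nat
  defines "G \<equiv> \<lambda>x i. \<Sum>l\<in>{1..d}. x l * W l i"
  shows "(\<integral>x. mean (\<lambda>i. b i + c * G x i) (G x) \<partial>std_gaussian d)
    = c * \<beta> * (\<integral>x. (\<Sum>l\<in>{1..d}. cov (\<lambda>i. b i + c * G x i) (W l) (W l)) \<partial>std_gaussian d)"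
    (is "_ = _ * (\<integral>x. (\<Sum>l\<in>{1..d}. ?cov l x) \<partial>?\<gamma>)")
    and "integrable (std_gaussian d) (\<lambda>x. \<Sum>l\<in>{1..d}. cov (\<lambda>i. b i + c * G x i) (W l) (W l))"
proof -
  interpret G: prob_space ?\<gamma> by (rule prob_space_std_gaussian)
  let ?Z = "\<lambda>x i. b i + c * G x i"
  have Gm [measurable]: "(\<lambda>x. G x i) \<in> borel_measurable ?\<gamma>" for i unfolding G_def by measurable
  \<comment> \<open>A crude bound on all coefficients at once; it serves integrability and
    boundedness and does not enter the result.\<close>
  define w where "w = (\<Sum>i\<in>K. \<Sum>l\<in>{1..d}. \<bar>W l i\<bar>)"
  have w: "\<bar>W l i\<bar> \<le> w" if "l \<in> {1..d}" "i \<in> K" for l i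
  proof -
    have "\<bar>W l i\<bar> \<le> (\<Sum>l\<in>{1..d}. \<bar>W l i\<bar>)" using that by (intro member_le_sum) auto
    also have "\<dots> \<le> w" unfolding w_def using that finite_K
      by (intro member_le_sum[of i K "\<lambda>i. \<Sum>l\<in>{1..d}. \<bar>W l i\<bar>"]) (auto intro: sum_nonneg)
    finally show ?thesis .
  qed
  have meas [measurable]: "(\<lambda>x. mean (?Z x) (W l)) \<in> borel_measurable ?\<gamma>" "?cov l \<in> borel_measurable ?\<gamma>" for l
    by (rule measurable_gibbs; measurable)+
  have int: "integrable ?\<gamma> (?cov l)" if "l \<in> {1..d}" for l
    using cov_abs_le[OF w w, OF that _ that] by (intro G.integrable_const_bound[where B = "2 * (w * w)"]) auto
  then show "integrable ?\<gamma> (\<lambda>x. \<Sum>l\<in>{1..d}. ?cov l x)"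
    by (intro Bochner_Integration.integrable_sum int)
  have upd: "((\<lambda>s. ?Z (x(l := s)) i) has_real_derivative c * W l i) (at t)" if l: "l \<in> {1..d}" for x l t i
  proof -
    have "?Z (x(l := s)) i = b i + c * (s * W l i + (\<Sum>l'\<in>{1..d} - {l}. x l' * W l' i))" for s
      unfolding G_def using l by (subst sum.remove[of _ l]) auto
    then show ?thesis by (simp only:) (auto intro!: derivative_eq_intros)
  qed
  have int1: "integrable ?\<gamma> (\<lambda>x. x l * mean (?Z x) (W l))" if l: "l \<in> {1..d}" for l
  proof (rule Bochner_Integration.integrable_bound[where f = "\<lambda>x. w * x l"])
    show "integrable ?\<gamma> (\<lambda>x. w * x l)"
      using integrable_std_gaussian_coordinate[OF l] by simp
    show "AE x in ?\<gamma>. norm (x l * mean (?Z x) (W l)) \<le> norm (w * x l)"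
    proof (rule AE_I2)
      fix x show "norm (x l * mean (?Z x) (W l)) \<le> norm (w * x l)"
        using mult_left_mono[OF order_trans[OF mean_abs_le[OF w[OF l], where y = "?Z x"] abs_ge_self], where c = "\<bar>x l\<bar>"]
        by (simp add: abs_mult mult_ac)
    qed
  qed (use l in simp)
  have "(\<integral>x. mean (?Z x) (G x) \<partial>?\<gamma>) = (\<integral>x. (\<Sum>l\<in>{1..d}. x l * mean (?Z x) (W l)) \<partial>?\<gamma>)"
    unfolding G_def by (simp only: mean_sum mean_cmult)
  also have "\<dots> = (\<Sum>l\<in>{1..d}. \<integral>x. x l * mean (?Z x) (W l) \<partial>?\<gamma>)"
    by (rule Bochner_Integration.integral_sum) (rule int1)
  also have "\<dots> = (\<Sum>l\<in>{1..d}. \<integral>x. c * \<beta> * ?cov l x \<partial>?\<gamma>)"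
  proof (intro sum.cong refl gaussian_integration_by_parts)
    fix l assume l: "l \<in> {1..d}"
    then show "l \<in> {1..d}" .
    fix x :: "nat \<Rightarrow> real"
    show "\<bar>mean (?Z x) (W l)\<bar> \<le> w" by (rule mean_abs_le[OF w[OF l]])
    have "\<bar>?cov l x\<bar> \<le> 2 * (w * w)" by (rule cov_abs_le[OF w w, OF l _ l])
    then show "\<bar>c * \<beta> * ?cov l x\<bar> \<le> \<bar>c * \<beta>\<bar> * (2 * (w * w))"
      unfolding abs_mult[of "c * \<beta>"] by (intro mult_left_mono) auto
    fix t
    show "((\<lambda>s. mean (?Z (x(l := s))) (W l)) has_real_derivative c * \<beta> * ?cov l (x(l := t))) (at t)"
      using mean_deriv[OF upd[OF l], where d = "W l"] by (simp add: cov_cmult mult_ac)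
    show "isCont (\<lambda>s. c * \<beta> * ?cov l (x(l := s))) t"
      by (intro continuous_intros cov_deriv_isCont[OF upd[OF l]])
  qed measurable
  also have "\<dots> = c * \<beta> * (\<integral>x. (\<Sum>l\<in>{1..d}. ?cov l x) \<partial>?\<gamma>)"
    using int by (simp add: sum_distrib_left)
  finally show "(\<integral>x. mean (?Z x) (G x) \<partial>?\<gamma>) = c * \<beta> * (\<integral>x. (\<Sum>l\<in>{1..d}. ?cov l x) \<partial>?\<gamma>)" .
qed

text \<open>Both inputs have the same covariances, so the second-order terms of the derivative along the
  rotation path \<open>sin \<theta> * S + cos \<theta> * G\<close> cancel and only third-order errors remain.\<close>
lemma lse_invariance:
  fixes \<xi> :: "nat \<Rightarrow> nat \<Rightarrow> 'a \<Rightarrow> real" and W :: "nat \<Rightarrow> 'a \<Rightarrow> real" and d n :: nat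
  defines "G \<equiv> \<lambda>x i. \<Sum>l\<in>{1..d}. x l * W l i"
    and "S \<equiv> \<lambda>w i. \<Sum>j\<in>{1..n}. \<xi> j (w j) i"
  assumes k: "k > 0"
    and centred: "\<And>j i. j \<in> {1..n} \<Longrightarrow> i \<in> K \<Longrightarrow> (\<Sum>u\<in>omega k. \<xi> j u i) = 0"
    and bd: "\<And>j u i. j \<in> {1..n} \<Longrightarrow> u \<in> omega k \<Longrightarrow> i \<in> K \<Longrightarrow> \<bar>\<xi> j u i\<bar> \<le> D j"
    and cov_eq: "\<And>i m. i \<in> K \<Longrightarrow> m \<in> K \<Longrightarrow>
      (\<Sum>j\<in>{1..n}. \<Sum>u\<in>omega k. \<xi> j u i * \<xi> j u m) = k * (\<Sum>l\<in>{1..d}. W l i * W l m)"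
  shows "\<bar>cube_avg k n (\<lambda>w. lse (S w)) - (\<integral>x. lse (G x) \<partial>std_gaussian d)\<bar> \<le> 24 * \<beta>\<^sup>2 * (\<Sum>j\<in>{1..n}. D j ^ 3)"
proof -
  let ?\<gamma> = "std_gaussian d"
  interpret G: prob_space ?\<gamma> by (rule prob_space_std_gaussian)
  have Gm [measurable]: "(\<lambda>x. G x i) \<in> borel_measurable ?\<gamma>" for i unfolding G_def by measurable
  have Gint: "integrable ?\<gamma> (\<lambda>x. G x i)" for i
    unfolding G_def using integrable_std_gaussian_coordinate by auto
  define Z where "Z \<theta> w x i = sin \<theta> * S w i + cos \<theta> * G x i" for \<theta> w x i
  define Z' where "Z' \<theta> w x i = cos \<theta> * S w i - sin \<theta> * G x i" for \<theta> w x i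
  \<comment> \<open>An integrable majorant that is independent of \<open>\<theta>\<close>, as
    differentiation under the integral requires.\<close>
  define B where "B w x = (\<Sum>i\<in>K. \<bar>S w i\<bar> + \<bar>G x i\<bar>)" for w x
  have Bint: "integrable ?\<gamma> (B w)" for w unfolding B_def using Gint by auto
  have B: "\<bar>S w i\<bar> + \<bar>G x i\<bar> \<le> B w x" if "i \<in> K" for w x i
    unfolding B_def using that finite_K by (intro member_le_sum) auto
  have comb: "\<bar>a * S w i + b * G x i\<bar> \<le> B w x" if "\<bar>a\<bar> \<le> 1" "\<bar>b\<bar> \<le> 1" "i \<in> K" for a b w x i
  proof -
    have "\<bar>a * S w i\<bar> \<le> \<bar>S w i\<bar>" "\<bar>b * G x i\<bar> \<le> \<bar>G x i\<bar>"
      using that by (simp_all add: abs_mult mult_left_le_one_le)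
    then show ?thesis using B[OF that(3), of w x] by linarith
  qed
  have ZB: "\<bar>Z \<theta> w x i\<bar> \<le> B w x" and Z'B: "\<bar>Z' \<theta> w x i\<bar> \<le> B w x" if "i \<in> K" for \<theta> w x i
    using comb[OF _ _ that, of "sin \<theta>" "cos \<theta>" w x] comb[OF _ _ that, of "cos \<theta>" "- sin \<theta>" w x]
    by (simp_all add: Z_def Z'_def)
  have meas [measurable]: "(\<lambda>x. lse (Z \<theta> w x)) \<in> borel_measurable ?\<gamma>"
    "(\<lambda>x. mean (Z \<theta> w x) (Z' \<theta> w x)) \<in> borel_measurable ?\<gamma>"
    "(\<lambda>x. mean (Z \<theta> w x) (S w)) \<in> borel_measurable ?\<gamma>"
    "(\<lambda>x. mean (Z \<theta> w x) (G x)) \<in> borel_measurable ?\<gamma>" for \<theta> w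
    unfolding Z_def Z'_def by (rule measurable_gibbs; measurable)+
  have int: "integrable ?\<gamma> (\<lambda>x. lse (Z \<theta> w x))" for \<theta> w
    by (rule integrable_dominated[OF _ _ abs_lse_le[OF ZB]]) (use Bint in auto)
  have intS: "integrable ?\<gamma> (\<lambda>x. mean (Z \<theta> w x) (S w))" for \<theta> w
    by (rule integrable_dominated[OF Bint]) (use comb[of 1 0 _ w] in \<open>auto intro: mean_abs_le\<close>)
  have intG: "integrable ?\<gamma> (\<lambda>x. mean (Z \<theta> w x) (G x))" for \<theta> w
    by (rule integrable_dominated[OF Bint]) (use comb[of 0 1 _ w] in \<open>auto intro: mean_abs_le\<close>)
  define \<Psi> where "\<Psi> \<theta> = cube_avg k n (\<lambda>w. \<integral>x. lse (Z \<theta> w x) \<partial>?\<gamma>)" for \<theta>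
  define \<Psi>' where "\<Psi>' \<theta> = cube_avg k n (\<lambda>w. \<integral>x. mean (Z \<theta> w x) (Z' \<theta> w x) \<partial>?\<gamma>)" for \<theta>
  have "((\<lambda>\<theta>. \<integral>x. lse (Z \<theta> w x) \<partial>?\<gamma>) has_real_derivative (\<integral>x. mean (Z \<theta> w x) (Z' \<theta> w x) \<partial>?\<gamma>)) (at \<theta>)" for \<theta> w
  proof (rule has_real_derivative_integral[where B = "B w"])
    show "((\<lambda>\<theta>. lse (Z \<theta> w x)) has_real_derivative mean (Z \<theta> w x) (Z' \<theta> w x)) (at \<theta>)" for x \<theta>
      by (rule lse_deriv) (auto simp: Z_def Z'_def intro!: derivative_eq_intros)
    show "\<bar>mean (Z \<theta> w x) (Z' \<theta> w x)\<bar> \<le> B w x" for x \<theta>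
      by (rule mean_abs_le[OF Z'B])
  qed (use int Bint in auto)
  then have deriv: "(\<Psi> has_real_derivative \<Psi>' \<theta>) (at \<theta>)" for \<theta>
    unfolding \<Psi>_def \<Psi>'_def cube_avg_def by (intro DERIV_cdivide DERIV_sum)
  define E where "E = 12 * \<beta>\<^sup>2 * (\<Sum>j\<in>{1..n}. D j ^ 3)"
  define V where "V y = (\<Sum>l\<in>{1..d}. cov y (W l) (W l))" for y
  \<comment> \<open>The Gaussian second-order term equals the discrete one. The discrete family is
    indexed by pairs \<open>(j, u)\<close>, and the factor \<open>k\<close> is the number of values
    of \<open>u\<close>.\<close>
  have V: "V y = (\<Sum>j\<in>{1..n}. (\<Sum>u\<in>omega k. cov y (\<xi> j u) (\<xi> j u)) / k)" for y
  proof -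
    have "(\<Sum>a\<in>{1..n} \<times> omega k. cov y (\<xi> (fst a) (snd a)) (\<xi> (fst a) (snd a))) = k * V y"
      unfolding V_def
    proof (rule sum_cov_cong)
      fix i m assume "i \<in> K" "m \<in> K"
      then show "(\<Sum>a\<in>{1..n} \<times> omega k. \<xi> (fst a) (snd a) i * \<xi> (fst a) (snd a) m) = k * (\<Sum>l\<in>{1..d}. W l i * W l m)"
        using cov_eq by (simp add: sum.cartesian_product case_prod_beta)
    qed
    then show ?thesis using k by (simp add: sum.cartesian_product case_prod_beta sum_divide_distrib[symmetric])
  qed
  have intV: "integrable ?\<gamma> (\<lambda>x. V (Z \<theta> w x))" for \<theta> w
    using gaussian_mean(2)[of d "\<lambda>i. sin \<theta> * S w i" "cos \<theta>" W] unfolding V_def Z_def G_def .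
  have \<Psi>'_le: "\<bar>\<Psi>' \<theta>\<bar> \<le> E" for \<theta>
  proof -
    define v where "v = cube_avg k n (\<lambda>w. \<integral>x. V (Z \<theta> w x) \<partial>?\<gamma>)"
    have "(\<integral>x. mean (Z \<theta> w x) (G x) \<partial>?\<gamma>) = cos \<theta> * \<beta> * (\<integral>x. V (Z \<theta> w x) \<partial>?\<gamma>)" for w
      using gaussian_mean(1)[of d "\<lambda>i. sin \<theta> * S w i" "cos \<theta>" W] unfolding V_def Z_def G_def .
    then have 1: "cube_avg k n (\<lambda>w. \<integral>x. mean (Z \<theta> w x) (G x) \<partial>?\<gamma>) = cos \<theta> * \<beta> * v"
      unfolding v_def by (simp only: cube_avg_cmult)
    \<comment> \<open>With \<open>x\<close> fixed, the Gaussian part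
      \<open>cos \<theta> * G x\<close> is a constant shift, so discrete integration by parts
      applies with \<open>s = sin \<theta>\<close> and can be summed over \<open>j\<close>.\<close>
    have pointwise: "\<bar>cube_avg k n (\<lambda>w. mean (Z \<theta> w x) (S w)) - sin \<theta> * \<beta> * cube_avg k n (\<lambda>w. V (Z \<theta> w x))\<bar> \<le> E" for x
    proof -
      have Zx: "Z \<theta> w x = (\<lambda>i. cos \<theta> * G x i + sin \<theta> * (\<Sum>j\<in>{1..n}. \<xi> j (w j) i))" for w
        by (simp add: Z_def S_def add.commute fun_eq_iff)
      let ?T = "\<lambda>j. cube_avg k n (\<lambda>w. mean (Z \<theta> w x) (\<xi> j (w j)))
        - sin \<theta> * \<beta> * cube_avg k n (\<lambda>w. (\<Sum>u\<in>omega k. cov (Z \<theta> w x) (\<xi> j u) (\<xi> j u)) / k)"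
      have "cube_avg k n (\<lambda>w. mean (Z \<theta> w x) (S w)) - sin \<theta> * \<beta> * cube_avg k n (\<lambda>w. V (Z \<theta> w x))
          = (\<Sum>j\<in>{1..n}. ?T j)"
        unfolding S_def V mean_sum cube_avg_sum sum_subtractf sum_distrib_left ..
      also have "\<bar>\<dots>\<bar> \<le> (\<Sum>j\<in>{1..n}. 12 * \<beta>\<^sup>2 * D j ^ 3)"
        by (intro order_trans[OF sum_abs] sum_mono)
          (unfold Zx, rule discrete_integration_by_parts, use k centred bd in auto)
      finally show ?thesis by (simp add: E_def sum_distrib_left)
    qed
    have "\<bar>\<integral>x. cube_avg k n (\<lambda>w. mean (Z \<theta> w x) (S w)) - sin \<theta> * \<beta> * cube_avg k n (\<lambda>w. V (Z \<theta> w x)) \<partial>?\<gamma>\<bar> \<le> E"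
    proof -
      have "0 \<le> E" using order_trans[OF abs_ge_zero pointwise] .
      have "integrable ?\<gamma> (\<lambda>x. cube_avg k n (\<lambda>w. mean (Z \<theta> w x) (S w)) - sin \<theta> * \<beta> * cube_avg k n (\<lambda>w. V (Z \<theta> w x)))"
        using intS intV by (intro Bochner_Integration.integrable_diff integrable_mult_right cube_avg_integral(2)) auto
      then have "(\<integral>x. \<bar>cube_avg k n (\<lambda>w. mean (Z \<theta> w x) (S w)) - sin \<theta> * \<beta> * cube_avg k n (\<lambda>w. V (Z \<theta> w x))\<bar> \<partial>?\<gamma>) \<le> (\<integral>x. E \<partial>?\<gamma>)"
        using pointwise by (intro integral_mono integrable_abs) auto
      then show ?thesis using order_trans[OF integral_abs_bound] by (simp add: G.prob_space)
    qed
    also have "(\<integral>x. cube_avg k n (\<lambda>w. mean (Z \<theta> w x) (S w)) - sin \<theta> * \<beta> * cube_avg k n (\<lambda>w. V (Z \<theta> w x)) \<partial>?\<gamma>)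
        = cube_avg k n (\<lambda>w. \<integral>x. mean (Z \<theta> w x) (S w) \<partial>?\<gamma>) - sin \<theta> * \<beta> * v"
      using intS intV unfolding v_def by (simp add: cube_avg_integral)
    finally have 2: "\<bar>cube_avg k n (\<lambda>w. \<integral>x. mean (Z \<theta> w x) (S w) \<partial>?\<gamma>) - sin \<theta> * \<beta> * v\<bar> \<le> E" .
    have "mean (Z \<theta> w x) (Z' \<theta> w x) = cos \<theta> * mean (Z \<theta> w x) (S w) - sin \<theta> * mean (Z \<theta> w x) (G x)" for w x
      using mean_add[of "Z \<theta> w x" "\<lambda>i. cos \<theta> * S w i" "\<lambda>i. - sin \<theta> * G x i"]
      by (simp only: mean_cmult) (simp add: Z'_def[abs_def])
    then have "\<Psi>' \<theta> = cos \<theta> * cube_avg k n (\<lambda>w. \<integral>x. mean (Z \<theta> w x) (S w) \<partial>?\<gamma>)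
        - sin \<theta> * cube_avg k n (\<lambda>w. \<integral>x. mean (Z \<theta> w x) (G x) \<partial>?\<gamma>)"
      unfolding \<Psi>'_def using intS intG by (simp add: cube_avg_diff cube_avg_cmult)
    \<comment> \<open>The cancellation: the Gaussian part contributes exactly
      \<open>- sin \<theta> * (cos \<theta> * \<beta> * v)\<close>, which is absorbed into the
      discrete difference bounded by \<open>E\<close>.\<close>
    also have "\<dots> = cos \<theta> * (cube_avg k n (\<lambda>w. \<integral>x. mean (Z \<theta> w x) (S w) \<partial>?\<gamma>) - sin \<theta> * \<beta> * v)"
      unfolding 1 by (simp add: algebra_simps)
    also have "\<bar>\<dots>\<bar> \<le> 1 * E"
      unfolding abs_mult by (intro mult_mono 2) auto
    finally show ?thesis by simp
  qed
  \<comment> \<open>The path starts at \<open>G\<close> and ends at \<open>S\<close>. Its length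
    \<open>pi / 2\<close> is below 2, which turns the constant 12 in \<open>E\<close> into
    24.\<close>
  have "norm (\<Psi> (pi / 2) - \<Psi> 0) \<le> E * norm (pi / 2 - 0)"
    by (rule field_differentiable_bound[where S = UNIV, OF _ deriv]) (use \<Psi>'_le in auto)
  also have "\<dots> \<le> E * 2"
    using order_trans[OF abs_ge_zero \<Psi>'_le] pi_half_less_two by (intro mult_left_mono) auto
  also have "\<Psi> (pi / 2) = cube_avg k n (\<lambda>w. lse (S w))"
    unfolding \<Psi>_def Z_def by (simp add: G.prob_space)
  also have "\<Psi> 0 = (\<integral>x. lse (G x) \<partial>?\<gamma>)"
    unfolding \<Psi>_def Z_def cube_avg_def using k by (simp add: card_cube)
  finally show ?thesis by (simp add: E_def)
qed

end

subsection \<open>Realising Gram matrices\<close>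

text \<open>Gram-Schmidt by induction on the number of vectors. Linearly dependent families are
  allowed: a step with zero residual records a zero vector \<open>U a\<close> together with a zero
  row \<open>W a\<close>, so no rank has to be tracked.\<close>

lemma gram_schmidt_coefficients:
  fixes v :: "nat \<Rightarrow> 'b \<Rightarrow> real"
  assumes "finite J"
  shows "\<exists>U W. (\<forall>a\<in>{1..p::nat}. \<forall>b\<in>{1..p}. a \<noteq> b \<longrightarrow> (\<Sum>j\<in>J. U a j * U b j) = 0) \<and>
    (\<forall>a\<in>{1..p}. (\<Sum>j\<in>J. U a j * U a j) = 1 \<or> (\<forall>j\<in>J. U a j = 0) \<and> (\<forall>i\<in>{1..p}. W a i = 0)) \<and>
    (\<forall>i\<in>{1..p}. \<forall>j\<in>J. v i j = (\<Sum>a\<in>{1..p}. W a i * U a j))"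
    (is "\<exists>U W. ?orth p U \<and> ?normed p U W \<and> ?expand p U W")
proof (induction p)
  case (Suc p)
  then obtain U W where orth: "?orth p U" and normed: "?normed p U W" and expand: "?expand p U W" by blast
  define c where "c a = (\<Sum>j\<in>J. v (Suc p) j * U a j)" for a
  define r where "r j = v (Suc p) j - (\<Sum>a\<in>{1..p}. c a * U a j)" for j
  define s where "s = sqrt (\<Sum>j\<in>J. r j * r j)"
  \<comment> \<open>\<open>r\<close> is the residual of the new vector after projection and
    \<open>s\<close> its norm. If \<open>s = 0\<close>, division by zero yields the zero vector,
    which is the degenerate case of the invariant.\<close>
  define U' where "U' = U(Suc p := (\<lambda>j. r j / s))"
  define W' where "W' a i = (if i = Suc p then (if a = Suc p then s else c a) else if a = Suc p then 0 else W a i)" for a i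
  have ss: "s * s = (\<Sum>j\<in>J. r j * r j)" unfolding s_def by (simp add: sum_nonneg)
  have r0: "r j = 0" if "s = 0" "j \<in> J" for j
    using ss that assms by (simp add: sum_nonneg_eq_0_iff)
  \<comment> \<open>Zero rows stay zero when the column for the new vector is added.\<close>
  have c0: "c a = 0" if "\<forall>j\<in>J. U a j = 0" for a using that by (simp add: c_def)
  have r_orth: "(\<Sum>j\<in>J. r j * U b j) = 0" if b: "b \<in> {1..p}" for b
  proof -
    have "(\<Sum>j\<in>J. r j * U b j) = c b - (\<Sum>a\<in>{1..p}. c a * (\<Sum>j\<in>J. U a j * U b j))"
      unfolding r_def c_def[of b]
      by (simp add: left_diff_distrib sum_subtractf sum_distrib_left sum_distrib_right mult.assoc, subst sum.swap) simp
    also have "(\<Sum>a\<in>{1..p}. c a * (\<Sum>j\<in>J. U a j * U b j)) = c b * (\<Sum>j\<in>J. U b j * U b j)"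
      using b orth by (subst sum.remove[of _ b]) auto
    also have "\<dots> = c b" using normed b c0 by auto
    finally show ?thesis by simp
  qed
  have "?orth (Suc p) U'"
    using orth r_orth by (auto simp: U'_def atLeastAtMostSuc_conv mult.commute sum_divide_distrib[symmetric])
  moreover have "?normed (Suc p) U' W'"
  proof
    fix a assume a: "a \<in> {1..Suc p}"
    show "(\<Sum>j\<in>J. U' a j * U' a j) = 1 \<or> (\<forall>j\<in>J. U' a j = 0) \<and> (\<forall>i\<in>{1..Suc p}. W' a i = 0)"
    proof (cases "a = Suc p")
      case True
      then show ?thesis
        using ss by (cases "s = 0") (auto simp: U'_def W'_def sum_divide_distrib[symmetric])
    next
      case False
      then show ?thesis using a normed c0 by (auto simp: U'_def W'_def)
    qed
  qed
  moreover have "?expand (Suc p) U' W'"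
  proof (intro ballI)
    fix i j assume i: "i \<in> {1..Suc p}" and j: "j \<in> J"
    have "(\<Sum>a\<in>{1..p}. W' a i * U' a j) = (\<Sum>a\<in>{1..p}. (if i = Suc p then c a else W a i) * U a j)"
      by (intro sum.cong) (auto simp: U'_def W'_def)
    moreover have "W' (Suc p) i * U' (Suc p) j = (if i = Suc p then r j else 0)"
      using r0[OF _ j] by (auto simp: U'_def W'_def)
    ultimately show "v i j = (\<Sum>a\<in>{1..Suc p}. W' a i * U' a j)"
      using i j expand by (auto simp: r_def)
  qed
  ultimately show ?case by blast
qed auto

text \<open>Inserting the Gram-Schmidt expansion, orthogonality removes the cross terms; a diagonal
  term is multiplied by 1 unless its coefficients in \<open>W\<close> already vanish.
  \<open>W\<close> is thus a Cholesky-type factor of the Gram matrix.\<close>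

lemma gram_realisation:
  fixes v :: "nat \<Rightarrow> 'b \<Rightarrow> real"
  assumes "finite J"
  obtains W where "\<And>i m. i \<in> {1..p::nat} \<Longrightarrow> m \<in> {1..p} \<Longrightarrow>
    (\<Sum>j\<in>J. v i j * v m j) = (\<Sum>l\<in>{1..p}. W l i * W l m)"
proof -
  obtain U W where
    UW: "(\<forall>a\<in>{1..p}. \<forall>b\<in>{1..p}. a \<noteq> b \<longrightarrow> (\<Sum>j\<in>J. U a j * U b j) = 0) \<and>
    (\<forall>a\<in>{1..p}. (\<Sum>j\<in>J. U a j * U a j) = 1 \<or> (\<forall>j\<in>J. U a j = 0) \<and> (\<forall>i\<in>{1..p}. W a i = 0)) \<and>
    (\<forall>i\<in>{1..p}. \<forall>j\<in>J. v i j = (\<Sum>a\<in>{1..p}. W a i * U a j))"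
    using gram_schmidt_coefficients[OF assms, of p v] by (elim exE) (rule that)
  have orth: "(\<Sum>j\<in>J. U a j * U b j) = 0" if "a \<in> {1..p}" "b \<in> {1..p}" "a \<noteq> b" for a b
    using UW that by blast
  have normed: "(\<Sum>j\<in>J. U a j * U a j) = 1 \<or> (\<forall>i\<in>{1..p}. W a i = 0)" if "a \<in> {1..p}" for a
    using UW that by blast
  have expand: "v i j = (\<Sum>a\<in>{1..p}. W a i * U a j)" if "i \<in> {1..p}" "j \<in> J" for i j
    using UW that by blast
  have "(\<Sum>j\<in>J. v i j * v m j) = (\<Sum>l\<in>{1..p}. W l i * W l m)" if i: "i \<in> {1..p}" and m: "m \<in> {1..p}" for i m
  proof -
    have "(\<Sum>j\<in>J. v i j * v m j) = (\<Sum>j\<in>J. \<Sum>a\<in>{1..p}. \<Sum>b\<in>{1..p}. W a i * W b m * (U a j * U b j))"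
      using expand i m by (intro sum.cong refl) (simp add: sum_product mult_ac)
    also have "\<dots> = (\<Sum>a\<in>{1..p}. \<Sum>b\<in>{1..p}. W a i * W b m * (\<Sum>j\<in>J. U a j * U b j))"
      by (subst sum.swap, intro sum.cong refl, subst sum.swap) (simp add: sum_distrib_left)
    also have "\<dots> = (\<Sum>a\<in>{1..p}. W a i * W a m)"
    proof (rule sum.cong[OF refl])
      fix a assume a: "a \<in> {1..p}"
      have "(\<Sum>b\<in>{1..p}. W a i * W b m * (\<Sum>j\<in>J. U a j * U b j)) = W a i * W a m * (\<Sum>j\<in>J. U a j * U a j)"
        using a orth by (subst sum.remove[of _ a]) auto
      also have "\<dots> = W a i * W a m" using normed[OF a] i by auto
      finally show "(\<Sum>b\<in>{1..p}. W a i * W b m * (\<Sum>j\<in>J. U a j * U b j)) = W a i * W a m" .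
    qed
    finally show ?thesis .
  qed
  then show ?thesis using that by blast
qed

text \<open>Vectors with sum zero span one dimension less than their number, so \<open>k - 1\<close> Gaussian coordinates suffice.\<close>
lemma gram_realisation_sum_zero:
  fixes v :: "nat \<Rightarrow> 'b \<Rightarrow> real"
  assumes J: "finite J" and zero: "\<And>j. j \<in> J \<Longrightarrow> (\<Sum>i\<in>{1..Suc p}. v i j) = 0"
  obtains W where "\<And>i m. i \<in> {1..Suc p} \<Longrightarrow> m \<in> {1..Suc p} \<Longrightarrow>
    (\<Sum>j\<in>J. v i j * v m j) = (\<Sum>l\<in>{1..p}. W l i * W l m)"
proof -
  obtain W where W: "\<And>i m. i \<in> {1..p} \<Longrightarrow> m \<in> {1..p} \<Longrightarrow>
    (\<Sum>j\<in>J. v i j * v m j) = (\<Sum>l\<in>{1..p}. W l i * W l m)"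
    using gram_realisation[OF J] by blast
  \<comment> \<open>The last column is forced by the sum-zero condition: it repeats for
    \<open>W\<close> the relation that expresses \<open>v (Suc p)\<close> by the other
    vectors.\<close>
  define W' where "W' l i = (if i = Suc p then - (\<Sum>i\<in>{1..p}. W l i) else W l i)" for l i
  have v: "v (Suc p) j = - (\<Sum>i\<in>{1..p}. v i j)" if "j \<in> J" for j using zero[OF that] by simp
  have left: "(\<Sum>j\<in>J. v (Suc p) j * q j) = - (\<Sum>i\<in>{1..p}. \<Sum>j\<in>J. v i j * q j)" for q
  proof -
    have "(\<Sum>j\<in>J. v (Suc p) j * q j) = (\<Sum>j\<in>J. - (\<Sum>i\<in>{1..p}. v i j * q j))"
      by (intro sum.cong refl) (simp add: v sum_distrib_right)
    then show ?thesis by (subst sum.swap) (simp add: sum_negf)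
  qed
  have left': "(\<Sum>l\<in>{1..p}. W' l (Suc p) * q l) = - (\<Sum>i\<in>{1..p}. \<Sum>l\<in>{1..p}. W' l i * q l)" for q
  proof -
    have "(\<Sum>l\<in>{1..p}. W' l (Suc p) * q l) = (\<Sum>l\<in>{1..p}. - (\<Sum>i\<in>{1..p}. W' l i * q l))"
      by (intro sum.cong refl) (simp add: W'_def sum_distrib_right)
    then show ?thesis by (subst sum.swap) (simp add: sum_negf)
  qed
  have 1: "(\<Sum>j\<in>J. v i j * v m j) = (\<Sum>l\<in>{1..p}. W' l i * W' l m)" if "i \<in> {1..p}" "m \<in> {1..p}" for i m
    using W[OF that] that by (simp add: W'_def)
  \<comment> \<open>Both sides are bilinear and obey the same relation in the last index, so the
    identity extends to \<open>Suc p\<close> first in \<open>i\<close>, then by symmetry in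
    \<open>m\<close>.\<close>
  have 2: "(\<Sum>j\<in>J. v i j * v m j) = (\<Sum>l\<in>{1..p}. W' l i * W' l m)" if "i \<in> {1..Suc p}" "m \<in> {1..p}" for i m
  proof (cases "i = Suc p")
    case True
    show ?thesis unfolding True left left'
      by (intro arg_cong[where f = uminus] sum.cong refl 1 that(2))
  next
    case False
    then show ?thesis by (intro 1) (use that in auto)
  qed
  have "(\<Sum>j\<in>J. v i j * v m j) = (\<Sum>l\<in>{1..p}. W' l i * W' l m)" if i: "i \<in> {1..Suc p}" and m: "m \<in> {1..Suc p}" for i m
  proof (cases "m = Suc p")
    case True
    have "(\<Sum>j\<in>J. v m j * v i j) = (\<Sum>l\<in>{1..p}. W' l m * W' l i)"
      unfolding True left left'
      by (intro arg_cong[where f = uminus] sum.cong refl) (use 2[OF i] in \<open>simp add: mult.commute\<close>)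
    then show ?thesis by (simp add: mult.commute)
  next
    case False
    then show ?thesis by (intro 2 i) (use m in auto)
  qed
  then show ?thesis using that by blast
qed

subsection \<open>Level-one Fourier coefficients\<close>

text \<open>The Fourier coefficient at the multi-index with the single nonzero entry \<open>a\<close> in position \<open>j\<close>.\<close>
definition level_one_coeff ::
  "nat \<Rightarrow> nat \<Rightarrow> (nat \<Rightarrow> nat \<Rightarrow> real) \<Rightarrow> ((nat \<Rightarrow> nat) \<Rightarrow> real) \<Rightarrow> nat \<times> nat \<Rightarrow> real" where
  "level_one_coeff k n X g ja = cube_avg k n (\<lambda>w. g w * X (snd ja) (w (fst ja)))"

locale centred_basis =
  fixes k :: nat and X :: "nat \<Rightarrow> nat \<Rightarrow> real"
  assumes k_pos: "k > 0" and basis: "orthonormal_basis k X" and X_0: "w \<in> omega k \<Longrightarrow> X 0 w = 1"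
begin

text \<open>The restriction to \<open>{1..n}\<close> supplies the undefined values that members of
  \<open>multi_indices\<close> must have elsewhere.\<close>

definition single_index :: "nat \<Rightarrow> nat \<times> nat \<Rightarrow> nat \<Rightarrow> nat" where
  "single_index n ja = (\<lambda>i\<in>{1..n}. if i = fst ja then snd ja else 0)"

lemma single_index_inj: "inj_on (single_index n) ({1..n} \<times> {1..<k})"
proof (rule inj_onI, clarify)
  fix j a j' a' assume *: "j \<in> {1..n}" "a \<in> {1..<k}" "j' \<in> {1..n}" "a' \<in> {1..<k}"
    and eq: "single_index n (j, a) = single_index n (j', a')"
  have "single_index n (j, a) j = single_index n (j', a') j" "single_index n (j, a) j' = single_index n (j', a') j'"
    using eq by simp_all
  then show "j = j' \<and> a = a'" using * by (auto simp: single_index_def split: if_splits)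
qed

lemma single_index_image:
  "single_index n ` ({1..n} \<times> {1..<k}) = {\<sigma>\<in>multi_indices k n. index_weight n \<sigma> = 1}"
proof (intro equalityI subsetI)
  fix \<sigma> assume "\<sigma> \<in> single_index n ` ({1..n} \<times> {1..<k})"
  then obtain j a where j: "j \<in> {1..n}" and a: "a \<in> {1..<k}" and \<sigma>: "\<sigma> = single_index n (j, a)" by auto
  have "{i\<in>{1..n}. \<sigma> i \<noteq> 0} = {j}" using j a by (auto simp: \<sigma> single_index_def)
  then show "\<sigma> \<in> {\<sigma>\<in>multi_indices k n. index_weight n \<sigma> = 1}"
    using j a k_pos by (auto simp: index_weight_def multi_indices_def \<sigma> single_index_def PiE_iff)
next
  fix \<sigma> assume "\<sigma> \<in> {\<sigma>\<in>multi_indices k n. index_weight n \<sigma> = 1}"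
  then have \<sigma>: "\<sigma> \<in> {1..n} \<rightarrow>\<^sub>E {..<k}" and "card {i\<in>{1..n}. \<sigma> i \<noteq> 0} = 1"
    by (auto simp: multi_indices_def index_weight_def)
  then obtain j where j: "{i\<in>{1..n}. \<sigma> i \<noteq> 0} = {j}" by (auto simp: card_1_singleton_iff)
  then have "j \<in> {1..n}" "\<sigma> j \<noteq> 0" by auto
  moreover have "\<sigma> = single_index n (j, \<sigma> j)"
  proof
    fix i show "\<sigma> i = single_index n (j, \<sigma> j) i"
      using j \<sigma> by (cases "i \<in> {1..n}") (auto simp: single_index_def PiE_iff extensional_def)
  qed
  moreover have "\<sigma> j < k" using \<sigma> \<open>j \<in> {1..n}\<close> by (auto simp: PiE_iff)
  ultimately show "\<sigma> \<in> single_index n ` ({1..n} \<times> {1..<k})"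
    by (intro image_eqI[of _ _ "(j, \<sigma> j)"]) auto
qed

text \<open>All factors of the basis product except the one at \<open>fst ja\<close> equal
  \<open>X 0\<close>, hence 1.\<close>

lemma fourier_coeff_single_index:
  assumes "ja \<in> {1..n} \<times> {1..<k}"
  shows "fourier_coeff k n X g (single_index n ja) = level_one_coeff k n X g ja"
proof -
  obtain j a where ja: "ja = (j, a)" by (cases ja)
  have "single_index n ja \<in> multi_indices k n" using single_index_image assms by blast
  moreover have "basis_prod n X (single_index n ja) w = X a (w j)" if w: "w \<in> cube k n" for w
  proof -
    have "basis_prod n X (single_index n ja) w = (\<Prod>i\<in>{1..n}. if i = j then X a (w j) else 1)"
      unfolding basis_prod_def using w
      by (intro prod.cong refl) (auto simp: single_index_def ja cube_def PiE_iff X_0)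
    also have "\<dots> = X a (w j)" using assms ja by simp
    finally show ?thesis .
  qed
  ultimately show ?thesis
    using fourier_coeff_eq[OF basis k_pos] by (simp add: level_one_coeff_def cube_avg_def ja)
qed

lemma sum_level_one:
  assumes "A \<subseteq> {1..n} \<times> {1..<k}"
  shows "(\<Sum>ja\<in>A. (level_one_coeff k n X g ja)\<^sup>2) = (\<Sum>\<sigma>\<in>single_index n ` A. (fourier_coeff k n X g \<sigma>)\<^sup>2)"
  using assms fourier_coeff_single_index
  by (subst sum.reindex[OF inj_on_subset[OF single_index_inj assms]]) (auto intro!: sum.cong)

lemma OBJ_eq:
  "OBJ k n X f = (\<Sum>i\<in>{1..k}. \<Sum>ja\<in>{1..n} \<times> {1..<k}. (level_one_coeff k n X (\<lambda>w. f w i) ja)\<^sup>2)"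
  unfolding OBJ_def by (simp only: sum_level_one[OF order_refl] single_index_image)

text \<open>Once \<open>m \<ge> 1\<close>, the truncated influence includes every weight-one index
  that is nonzero at \<open>j\<close>; its remaining terms are squares.\<close>

lemma level_one_le_low_influence:
  assumes "j \<in> {1..n}" "m \<ge> 1"
  shows "(\<Sum>a\<in>{1..<k}. (level_one_coeff k n X g (j, a))\<^sup>2) \<le> low_influence k n X m j g"
proof -
  have "(\<Sum>a\<in>{1..<k}. (level_one_coeff k n X g (j, a))\<^sup>2) = (\<Sum>ja\<in>{j} \<times> {1..<k}. (level_one_coeff k n X g ja)\<^sup>2)"
    by (rule sum.reindex_bij_witness[where i = snd and j = "\<lambda>a. (j, a)"]) auto
  also have "\<dots> = (\<Sum>\<sigma>\<in>single_index n ` ({j} \<times> {1..<k}). (fourier_coeff k n X g \<sigma>)\<^sup>2)"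
    using assms by (intro sum_level_one) auto
  also have "\<dots> \<le> low_influence k n X m j g"
    unfolding low_influence_def
  proof (rule sum_mono2)
    show "finite {\<sigma> \<in> multi_indices k n. real (index_weight n \<sigma>) \<le> m \<and> \<sigma> j \<noteq> 0}"
      using finite_multi_indices by simp
    show "single_index n ` ({j} \<times> {1..<k}) \<subseteq> {\<sigma> \<in> multi_indices k n. real (index_weight n \<sigma>) \<le> m \<and> \<sigma> j \<noteq> 0}"
    proof
      fix \<sigma> assume \<sigma>: "\<sigma> \<in> single_index n ` ({j} \<times> {1..<k})"
      then have "\<sigma> j \<noteq> 0" using assms by (auto simp: single_index_def)
      moreover have "\<sigma> \<in> {\<sigma>\<in>multi_indices k n. index_weight n \<sigma> = 1}"
        using \<sigma> assms unfolding single_index_image[symmetric] by auto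
      ultimately show "\<sigma> \<in> {\<sigma> \<in> multi_indices k n. real (index_weight n \<sigma>) \<le> m \<and> \<sigma> j \<noteq> 0}"
        using assms by auto
    qed
  qed simp
  finally show ?thesis .
qed

text \<open>Squaring the coefficient formula gives a double sum over points of the cube, which
  completeness of the product basis collapses to the diagonal.\<close>

lemma parseval: "(\<Sum>\<sigma>\<in>multi_indices k n. (fourier_coeff k n X g \<sigma>)\<^sup>2) = cube_avg k n (\<lambda>w. (g w)\<^sup>2)"
proof -
  let ?B = "basis_prod n X" and ?C = "cube k n"
  have "(\<Sum>\<sigma>\<in>multi_indices k n. (fourier_coeff k n X g \<sigma>)\<^sup>2)
      = (\<Sum>\<sigma>\<in>multi_indices k n. (\<Sum>w\<in>?C. \<Sum>z\<in>?C. g w * g z * (?B \<sigma> w * ?B \<sigma> z))) / (real k ^ n)\<^sup>2"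
    unfolding sum_divide_distrib
    by (intro sum.cong refl)
      (simp add: fourier_coeff_eq[OF basis k_pos] power_divide power2_eq_square sum_product mult_ac
        flip: sum_divide_distrib)
  also have "(\<Sum>\<sigma>\<in>multi_indices k n. (\<Sum>w\<in>?C. \<Sum>z\<in>?C. g w * g z * (?B \<sigma> w * ?B \<sigma> z)))
      = (\<Sum>w\<in>?C. \<Sum>z\<in>?C. g w * g z * (\<Sum>\<sigma>\<in>multi_indices k n. ?B \<sigma> w * ?B \<sigma> z))"
    unfolding sum.swap[of _ ?C "multi_indices k n"] sum_distrib_left ..
  also have "\<dots> = (\<Sum>w\<in>?C. \<Sum>z\<in>?C. if w = z then (g w)\<^sup>2 * real k ^ n else 0)"
    by (intro sum.cong refl) (simp add: basis_prod_complete[OF basis] power2_eq_square)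
  also have "\<dots> = (\<Sum>w\<in>?C. (g w)\<^sup>2) * real k ^ n"
    by (simp add: finite_cube sum_distrib_right)
  finally show ?thesis using k_pos by (simp add: cube_avg_def power2_eq_square)
qed

lemma level_one_bessel:
  assumes "\<And>w. w \<in> cube k n \<Longrightarrow> \<bar>g w\<bar> \<le> 1"
  shows "(\<Sum>ja\<in>{1..n} \<times> {1..<k}. (level_one_coeff k n X g ja)\<^sup>2) \<le> 1"
proof -
  have "(\<Sum>ja\<in>{1..n} \<times> {1..<k}. (level_one_coeff k n X g ja)\<^sup>2)
      \<le> (\<Sum>\<sigma>\<in>multi_indices k n. (fourier_coeff k n X g \<sigma>)\<^sup>2)"
    unfolding sum_level_one[OF order_refl] single_index_image
    by (rule sum_mono2) (auto simp: finite_multi_indices)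
  also have "\<dots> \<le> 1"
    unfolding parseval using cube_avg_abs_le[OF k_pos, of n "\<lambda>w. (g w)\<^sup>2" 1] assms
    by (simp add: abs_square_le_1)
  finally show ?thesis .
qed

lemma sum_basis: "a \<in> {1..<k} \<Longrightarrow> (\<Sum>u\<in>omega k. X a u) = 0"
  using basis_orthonormal[OF basis, of 0 a] k_pos by (simp add: X_0)

text \<open>Resampling the coordinate \<open>fst ja\<close> averages a nonconstant basis function,
  which has mean zero.\<close>

lemma level_one_const: "ja \<in> {1..n} \<times> {1..<k} \<Longrightarrow> level_one_coeff k n X (\<lambda>_. c) ja = 0"
proof -
  assume ja: "ja \<in> {1..n} \<times> {1..<k}"
  then have "fst ja \<in> {1..n}" by auto
  from cube_avg_resample[OF this k_pos, of "\<lambda>w. c * X (snd ja) (w (fst ja))"] show ?thesis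
    using ja sum_basis[of "snd ja"]
    by (auto simp: level_one_coeff_def cube_avg_def sum_distrib_left[symmetric])
qed

lemma level_one_add:
  "level_one_coeff k n X (\<lambda>w. g w + h w) ja = level_one_coeff k n X g ja + level_one_coeff k n X h ja"
  by (simp add: level_one_coeff_def cube_avg_def distrib_right sum.distrib add_divide_distrib)

lemma level_one_diff:
  "level_one_coeff k n X (\<lambda>w. g w - h w) ja = level_one_coeff k n X g ja - level_one_coeff k n X h ja"
  by (simp add: level_one_coeff_def cube_avg_def left_diff_distrib sum_subtractf diff_divide_distrib)

lemma level_one_sum:
  "level_one_coeff k n X (\<lambda>w. \<Sum>i\<in>A. g i w) ja = (\<Sum>i\<in>A. level_one_coeff k n X (g i) ja)"
  by (simp add: level_one_coeff_def sum_distrib_right cube_avg_sum)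

lemma level_one_cong:
  "(\<And>w. w \<in> cube k n \<Longrightarrow> g w = h w) \<Longrightarrow> level_one_coeff k n X g ja = level_one_coeff k n X h ja"
  by (simp add: level_one_coeff_def cong: cube_avg_cong)

end

subsection \<open>The bound on the objective\<close>

text \<open>The left-hand side is the inner product of \<open>W\<close> with the Gaussian first
  moments \<open>z\<close> of the Gibbs weights. The squared norm of \<open>z\<close> is a
  \<open>gaussian_objective\<close>, hence at most \<open>gaussian_constant k\<close>. Bounding the
  product by half the sum of the squares keeps the estimate linear in the squared norm of
  \<open>W\<close>.\<close>

lemma gaussian_mean_le:
  fixes W :: "nat \<Rightarrow> nat \<Rightarrow> real" and k :: nat
  defines "G \<equiv> \<lambda>x i. \<Sum>l\<in>{1..k-1}. x l * W l i"
  assumes "gibbs {1..k} \<beta>"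
  shows "(\<integral>x. gibbs.mean {1..k} \<beta> (G x) (G x) \<partial>std_gaussian (k - 1))
      \<le> ((\<Sum>i\<in>{1..k}. \<Sum>l\<in>{1..k-1}. (W l i)\<^sup>2) + gaussian_constant k) / 2"
proof -
  interpret gibbs "{1..k}" \<beta> by fact
  let ?\<gamma> = "std_gaussian (k - 1)"
  define h where "h i x = exp (\<beta> * G x i) / partition_sum (G x)" for i x
  define z where "z l i = (\<integral>x. x l * h i x \<partial>?\<gamma>)" for l i
  have Gm [measurable]: "(\<lambda>x. G x i) \<in> borel_measurable ?\<gamma>" for i unfolding G_def by measurable
  have hm [measurable]: "h i \<in> borel_measurable ?\<gamma>" for i
    unfolding h_def partition_sum_def by measurable
  have h_nonneg: "0 \<le> h i x" for i x
    unfolding h_def using partition_sum_pos[of "G x"] by simp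
  have h_sum: "(\<Sum>i\<in>{1..k}. h i x) = 1" for x
    unfolding h_def sum_divide_distrib[symmetric] partition_sum_def[symmetric]
    using partition_sum_pos[of "G x"] by simp
  have h_le: "h i x \<le> 1" if "i \<in> {1..k}" for i x
    using member_le_sum[of i "{1..k}" "\<lambda>i. h i x"] that finite_K h_nonneg h_sum[of x] by simp
  have "fractional_partition k h"
    unfolding fractional_partition_def using hm h_nonneg h_sum by auto
  then have obj: "gaussian_objective k h \<le> gaussian_constant k"
    unfolding gaussian_constant_def by (intro cSup_upper gaussian_objective_bdd_above) auto
  have int: "integrable ?\<gamma> (\<lambda>x. x l * h i x)" if "l \<in> {1..k-1}" "i \<in> {1..k}" for l i
  proof (rule Bochner_Integration.integrable_bound[OF integrable_std_gaussian_coordinate[OF that(1)]])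
    show "(\<lambda>x. x l * h i x) \<in> borel_measurable ?\<gamma>" using that(1) by measurable
  qed (use that h_nonneg h_le in \<open>auto simp: abs_mult intro!: mult_left_le\<close>)
  have "mean (G x) (G x) = (\<Sum>i\<in>{1..k}. \<Sum>l\<in>{1..k-1}. W l i * (x l * h i x))" for x
  proof -
    have "mean (G x) (G x) = (\<Sum>i\<in>{1..k}. h i x * G x i)"
      unfolding mean_def h_def sum_divide_distrib by simp
    then show ?thesis by (simp add: G_def sum_distrib_left mult_ac)
  qed
  then have "(\<integral>x. mean (G x) (G x) \<partial>?\<gamma>) = (\<integral>x. (\<Sum>i\<in>{1..k}. \<Sum>l\<in>{1..k-1}. W l i * (x l * h i x)) \<partial>?\<gamma>)"
    by simp
  also have "\<dots> = (\<Sum>i\<in>{1..k}. \<integral>x. (\<Sum>l\<in>{1..k-1}. W l i * (x l * h i x)) \<partial>?\<gamma>)"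
    by (rule Bochner_Integration.integral_sum)
      (intro Bochner_Integration.integrable_sum integrable_mult_right int)
  also have "\<dots> = (\<Sum>i\<in>{1..k}. \<Sum>l\<in>{1..k-1}. W l i * z l i)"
  proof (rule sum.cong[OF refl])
    fix i assume "i \<in> {1..k}"
    then have "(\<integral>x. (\<Sum>l\<in>{1..k-1}. W l i * (x l * h i x)) \<partial>?\<gamma>) = (\<Sum>l\<in>{1..k-1}. \<integral>x. W l i * (x l * h i x) \<partial>?\<gamma>)"
      by (intro Bochner_Integration.integral_sum integrable_mult_right int)
    then show "(\<integral>x. (\<Sum>l\<in>{1..k-1}. W l i * (x l * h i x)) \<partial>?\<gamma>) = (\<Sum>l\<in>{1..k-1}. W l i * z l i)"
      by (simp add: z_def)
  qed
  also have "\<dots> \<le> (\<Sum>i\<in>{1..k}. \<Sum>l\<in>{1..k-1}. ((W l i)\<^sup>2 + (z l i)\<^sup>2) / 2)"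
  proof (intro sum_mono)
    fix i l show "W l i * z l i \<le> ((W l i)\<^sup>2 + (z l i)\<^sup>2) / 2"
      using sum_squares_bound[of "W l i" "z l i"] by simp
  qed
  also have "\<dots> = ((\<Sum>i\<in>{1..k}. \<Sum>l\<in>{1..k-1}. (W l i)\<^sup>2) + gaussian_objective k h) / 2"
    unfolding gaussian_objective_def
    by (simp add: L2_set_def sum_nonneg z_def sum_divide_distrib[symmetric] sum.distrib)
  finally show ?thesis using obj by simp
qed

context centred_basis begin

abbreviation "positions n \<equiv> {1..n} \<times> {1..<k}"

text \<open>Writing \<open>L\<close> for the left-hand side, the chain is: correlation of
  \<open>g\<close> with its level-one part, then \<open>lse\<close>, then its Gaussian analogue,
  then \<open>(L + gaussian_constant k) / 2\<close> plus errors. Since \<open>L\<close> reappears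
  with factor one half, it can be absorbed on the left.\<close>

lemma exact_partition_bound:
  fixes g :: "(nat \<Rightarrow> nat) \<Rightarrow> nat \<Rightarrow> real" and n :: nat and \<beta> \<delta> :: real
  defines "v \<equiv> \<lambda>i. level_one_coeff k n X (\<lambda>w. g w i)"
  assumes nonneg: "\<And>w i. w \<in> cube k n \<Longrightarrow> i \<in> {1..k} \<Longrightarrow> 0 \<le> g w i"
    and sum1: "\<And>w. w \<in> cube k n \<Longrightarrow> (\<Sum>i\<in>{1..k}. g w i) = 1"
    and infl: "\<And>i j. i \<in> {1..k} \<Longrightarrow> j \<in> {1..n} \<Longrightarrow> (\<Sum>a\<in>{1..<k}. (v i (j, a))\<^sup>2) \<le> \<delta>\<^sup>2"
    and \<delta>: "\<delta> \<ge> 0" and \<beta>: "\<beta> > 0"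
  shows "(\<Sum>i\<in>{1..k}. \<Sum>ja\<in>positions n. (v i ja)\<^sup>2)
    \<le> gaussian_constant k + 2 * k / \<beta> + 48 * \<beta>\<^sup>2 * real k ^ 3 * \<delta>"
proof -
  interpret gibbs "{1..k}" \<beta> by standard (use k_pos \<beta> in auto)
  let ?\<gamma> = "std_gaussian (k - 1)"
  define L where "L = (\<Sum>i\<in>{1..k}. \<Sum>ja\<in>positions n. (v i ja)\<^sup>2)"
  define \<xi> where "\<xi> j u i = (\<Sum>a\<in>{1..<k}. v i (j, a) * X a u)" for j u i
  define S where "S w i = (\<Sum>j\<in>{1..n}. \<xi> j (w j) i)" for w i
  \<comment> \<open>\<open>D2 j\<close> is the level-one influence of coordinate \<open>j\<close>
    summed over all components. By Cauchy-Schwarz, \<open>D j\<close> bounds the \<open>j\<close>-th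
    summand uniformly.\<close>
  define D2 where "D2 j = (\<Sum>i\<in>{1..k}. \<Sum>a\<in>{1..<k}. (v i (j, a))\<^sup>2)" for j
  define D where "D j = sqrt (k * D2 j)" for j
  have Suc_k: "{1..k} = {1..Suc (k - 1)}" using k_pos by simp
  have L_D2: "L = (\<Sum>j\<in>{1..n}. D2 j)"
    unfolding L_def D2_def sum.cartesian_product' by (rule sum.swap)
  have g_le: "\<bar>g w i\<bar> \<le> 1" if "w \<in> cube k n" "i \<in> {1..k}" for w i
    using member_le_sum[of i "{1..k}" "g w"] that nonneg sum1[OF that(1)] by simp
  have L_le: "L \<le> k"
  proof -
    have "L \<le> (\<Sum>i\<in>{1..k}. 1)"
      unfolding L_def v_def by (intro sum_mono level_one_bessel g_le)
    then show ?thesis by simp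
  qed
  have v_zero: "(\<Sum>i\<in>{1..k}. v i ja) = 0" if "ja \<in> positions n" for ja
    using level_one_sum[of n "\<lambda>i w. g w i" "{1..k}" ja] level_one_const[OF that, of 1]
      level_one_cong[of n "\<lambda>w. \<Sum>i\<in>{1..k}. g w i" "\<lambda>_. 1" ja] sum1
    by (simp add: v_def)
  obtain W where W: "\<And>i m. i \<in> {1..k} \<Longrightarrow> m \<in> {1..k} \<Longrightarrow>
      (\<Sum>ja\<in>positions n. v i ja * v m ja) = (\<Sum>l\<in>{1..k-1}. W l i * W l m)"
    using gram_realisation_sum_zero[where J = "positions n" and p = "k - 1" and v = v] v_zero unfolding Suc_k[symmetric] by auto
  define G where "G x i = (\<Sum>l\<in>{1..k-1}. x l * W l i)" for x i
  have L_W: "L = (\<Sum>i\<in>{1..k}. \<Sum>l\<in>{1..k-1}. (W l i)\<^sup>2)"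
    unfolding L_def using W by (intro sum.cong refl) (simp add: power2_eq_square)
  have cov_eq: "(\<Sum>j\<in>{1..n}. \<Sum>u\<in>omega k. \<xi> j u i * \<xi> j u m) = k * (\<Sum>l\<in>{1..k-1}. W l i * W l m)"
    if i: "i \<in> {1..k}" and m: "m \<in> {1..k}" for i m
  proof -
    have "(\<Sum>u\<in>omega k. \<xi> j u i * \<xi> j u m) = k * (\<Sum>a\<in>{1..<k}. v i (j, a) * v m (j, a))" for j
    proof -
      have "(\<Sum>u\<in>omega k. \<xi> j u i * \<xi> j u m)
          = (\<Sum>u\<in>omega k. \<Sum>a\<in>{1..<k}. \<Sum>b\<in>{1..<k}. v i (j, a) * v m (j, b) * (X a u * X b u))"
        by (simp add: \<xi>_def sum_product mult_ac)
      also have "\<dots> = (\<Sum>a\<in>{1..<k}. \<Sum>b\<in>{1..<k}. v i (j, a) * v m (j, b) * (\<Sum>u\<in>omega k. X a u * X b u))"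
        unfolding sum.swap[of _ "{1..<k}" "omega k"] sum_distrib_left ..
      also have "\<dots> = (\<Sum>a\<in>{1..<k}. \<Sum>b\<in>{1..<k}. if b = a then k * (v i (j, a) * v m (j, a)) else 0)"
        by (intro sum.cong refl) (auto simp: basis_orthonormal[OF basis])
      finally show ?thesis by (simp add: sum_distrib_left)
    qed
    then have "(\<Sum>j\<in>{1..n}. \<Sum>u\<in>omega k. \<xi> j u i * \<xi> j u m) = k * (\<Sum>ja\<in>positions n. v i ja * v m ja)"
      by (simp only: sum_distrib_left[symmetric] sum.cartesian_product')
    then show ?thesis using W[OF i m] by simp
  qed
  have centred: "(\<Sum>u\<in>omega k. \<xi> j u i) = 0" for j i
    unfolding \<xi>_def sum.swap[of _ "{1..<k}" "omega k"] sum_distrib_left[symmetric] using sum_basis by simp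
  have \<xi>_le: "\<bar>\<xi> j u i\<bar> \<le> D j" if "u \<in> omega k" "i \<in> {1..k}" for j u i
  proof -
    \<comment> \<open>Completeness at the diagonal point \<open>(u, u)\<close>, with the term
      \<open>a = 0\<close> dropped.\<close>
    have X2: "(\<Sum>a\<in>{1..<k}. (X a u)\<^sup>2) \<le> k"
    proof -
      have "(\<Sum>a\<in>{1..<k}. (X a u)\<^sup>2) \<le> (\<Sum>a<k. (X a u)\<^sup>2)" by (intro sum_mono2) auto
      then show ?thesis using basis_complete[OF basis that(1) that(1)] by (simp add: power2_eq_square)
    qed
    have D2: "(\<Sum>a\<in>{1..<k}. (v i (j, a))\<^sup>2) \<le> D2 j"
      unfolding D2_def using that(2)
      by (intro member_le_sum[of i "{1..k}" "\<lambda>i. \<Sum>a\<in>{1..<k}. (v i (j, a))\<^sup>2"]) (auto intro: sum_nonneg)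
    have "(\<xi> j u i)\<^sup>2 \<le> (\<Sum>a\<in>{1..<k}. (v i (j, a))\<^sup>2) * (\<Sum>a\<in>{1..<k}. (X a u)\<^sup>2)"
      unfolding \<xi>_def by (rule Cauchy_Schwarz_ineq_sum)
    also have "\<dots> \<le> D2 j * k"
      by (intro mult_mono D2 X2) (auto simp: D2_def intro!: sum_nonneg)
    finally show ?thesis unfolding D_def by (intro real_le_rsqrt) (simp add: mult.commute)
  qed
  have D_nonneg: "0 \<le> D2 j" "0 \<le> D j" for j by (auto simp: D_def D2_def intro!: sum_nonneg mult_nonneg_nonneg)
  \<comment> \<open>The bound must not depend on \<open>n\<close>: one factor \<open>D j\<close> is
    estimated by its maximum, at most \<open>k * \<delta>\<close>, and the remaining squares sum to
    \<open>k * L\<close>, at most \<open>k * k\<close> by Bessel.\<close>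
  have "(\<Sum>j\<in>{1..n}. D j ^ 3) \<le> (\<Sum>j\<in>{1..n}. k * \<delta> * (k * D2 j))"
  proof (rule sum_mono)
    fix j assume j: "j \<in> {1..n}"
    have "D2 j \<le> (\<Sum>i\<in>{1..k}. \<delta>\<^sup>2)" unfolding D2_def by (intro sum_mono infl j)
    then have "k * D2 j \<le> (k * \<delta>)\<^sup>2"
      using mult_left_mono[of "D2 j" "k * \<delta>\<^sup>2" "real k"] by (simp add: power2_eq_square mult_ac)
    then have "D j \<le> k * \<delta>" unfolding D_def using \<delta> by (intro real_le_lsqrt) (auto simp: D_nonneg)
    moreover have "(D j)\<^sup>2 = k * D2 j" unfolding D_def by (simp add: D_nonneg)
    ultimately have "D j * (D j)\<^sup>2 \<le> k * \<delta> * (k * D2 j)"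
      by (intro mult_mono) (auto simp: D_nonneg \<delta>)
    then show "D j ^ 3 \<le> k * \<delta> * (k * D2 j)" by (simp add: power3_eq_cube power2_eq_square mult.assoc)
  qed
  also have "\<dots> = k * \<delta> * k * L" by (simp add: L_D2 sum_distrib_left mult.assoc)
  also have "\<dots> \<le> k * \<delta> * k * k" using L_le \<delta> by (intro mult_left_mono) auto
  finally have D3: "(\<Sum>j\<in>{1..n}. D j ^ 3) \<le> real k ^ 3 * \<delta>" by (simp add: power3_eq_cube mult_ac)
  \<comment> \<open>One factor of each squared coefficient is replaced by its definition as an
    average against \<open>g\<close>.\<close>
  have "L = cube_avg k n (\<lambda>w. \<Sum>i\<in>{1..k}. g w i * S w i)"
  proof -
    have "L = (\<Sum>i\<in>{1..k}. \<Sum>j\<in>{1..n}. \<Sum>a\<in>{1..<k}. v i (j, a) * cube_avg k n (\<lambda>w. g w i * X a (w j)))"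
      unfolding L_def sum.cartesian_product' by (simp add: v_def level_one_coeff_def power2_eq_square)
    also have "\<dots> = cube_avg k n (\<lambda>w. \<Sum>i\<in>{1..k}. \<Sum>j\<in>{1..n}. \<Sum>a\<in>{1..<k}. v i (j, a) * (g w i * X a (w j)))"
      by (simp only: cube_avg_sum cube_avg_cmult)
    finally show ?thesis by (simp add: S_def \<xi>_def sum_distrib_left mult_ac)
  qed
  also have "\<dots> \<le> cube_avg k n (\<lambda>w. lse (S w))"
  proof (rule cube_avg_mono)
    fix w assume w: "w \<in> cube k n"
    have "(\<Sum>i\<in>{1..k}. g w i * S w i) \<le> (\<Sum>i\<in>{1..k}. g w i * lse (S w))"
      by (intro sum_mono mult_left_mono le_lse nonneg w)
    then show "(\<Sum>i\<in>{1..k}. g w i * S w i) \<le> lse (S w)"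
      using sum1[OF w] by (simp add: sum_distrib_right[symmetric])
  qed
  also have "\<dots> \<le> (\<integral>x. lse (G x) \<partial>?\<gamma>) + 24 * \<beta>\<^sup>2 * (real k ^ 3 * \<delta>)"
  proof -
    have "\<bar>cube_avg k n (\<lambda>w. lse (S w)) - (\<integral>x. lse (G x) \<partial>?\<gamma>)\<bar> \<le> 24 * \<beta>\<^sup>2 * (\<Sum>j\<in>{1..n}. D j ^ 3)"
      unfolding S_def[abs_def] G_def[abs_def]
      by (rule lse_invariance[OF k_pos centred \<xi>_le cov_eq])
    moreover have "24 * \<beta>\<^sup>2 * (\<Sum>j\<in>{1..n}. D j ^ 3) \<le> 24 * \<beta>\<^sup>2 * (real k ^ 3 * \<delta>)"
      using D3 by (intro mult_left_mono) auto
    ultimately show ?thesis by linarith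
  qed
  also have "(\<integral>x. lse (G x) \<partial>?\<gamma>) \<le> (L + gaussian_constant k) / 2 + k / \<beta>"
  proof -
    interpret G: prob_space ?\<gamma> by (rule prob_space_std_gaussian)
    have Gm [measurable]: "(\<lambda>x. G x i) \<in> borel_measurable ?\<gamma>" for i unfolding G_def by measurable
    have meas: "(\<lambda>x. lse (G x)) \<in> borel_measurable ?\<gamma>" "(\<lambda>x. mean (G x) (G x)) \<in> borel_measurable ?\<gamma>"
      by (rule measurable_gibbs; measurable)+
    define b where "b x = (\<Sum>i\<in>{1..k}. \<bar>G x i\<bar>)" for x
    have b: "\<bar>G x i\<bar> \<le> b x" if "i \<in> {1..k}" for x i
      unfolding b_def using that by (intro member_le_sum) auto
    have b_int: "integrable ?\<gamma> b"
      unfolding b_def G_def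
      by (intro Bochner_Integration.integrable_sum integrable_abs integrable_mult_left integrable_std_gaussian_coordinate)
    have int_lse: "integrable ?\<gamma> (\<lambda>x. lse (G x))"
      by (rule integrable_dominated[OF _ meas(1) abs_lse_le[OF b]])
        (intro Bochner_Integration.integrable_add b_int G.integrable_const)
    have int: "integrable ?\<gamma> (\<lambda>x. mean (G x) (G x))"
      by (rule integrable_dominated[OF b_int meas(2) mean_abs_le[OF b]])
    have "(\<integral>x. lse (G x) \<partial>?\<gamma>) \<le> (\<integral>x. mean (G x) (G x) + k / \<beta> \<partial>?\<gamma>)"
      by (intro integral_mono Bochner_Integration.integrable_add int_lse int G.integrable_const)
        (use lse_le_mean in auto)
    also have "\<dots> = (\<integral>x. mean (G x) (G x) \<partial>?\<gamma>) + k / \<beta>"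
      by (subst Bochner_Integration.integral_add[OF int G.integrable_const])
        (simp add: prob_space.prob_space[OF prob_space_std_gaussian])
    also have "(\<integral>x. mean (G x) (G x) \<partial>?\<gamma>) \<le> (L + gaussian_constant k) / 2"
      unfolding L_W G_def[abs_def] by (rule gaussian_mean_le[OF gibbs_axioms])
    finally show ?thesis by simp
  qed
  finally have "L \<le> (L + gaussian_constant k) / 2 + k / \<beta> + 24 * \<beta>\<^sup>2 * (real k ^ 3 * \<delta>)" by simp
  \<comment> \<open>Solving for \<open>L\<close> doubles both error terms.\<close>
  then show ?thesis unfolding L_def[symmetric] by (simp add: field_simps)
qed

text \<open>The unused mass \<open>1 - (\<Sum>i. f w i)\<close> is given to a single coordinate \<open>m\<close>. Writing \<open>v i\<close> for the
  level-one part of the \<open>i\<close>-th component and \<open>u = - (\<Sum>i. v i)\<close>, this changes the objective by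
  \<open>2 \<langle>v m, u\<rangle> + \<parallel>u\<parallel>\<^sup>2\<close>, and the sum over \<open>m\<close> of these changes is \<open>(k - 2) \<parallel>u\<parallel>\<^sup>2\<close>.\<close>
lemma solid_partition_bound:
  fixes f :: "(nat \<Rightarrow> nat) \<Rightarrow> nat \<Rightarrow> real" and n :: nat and \<beta> \<eta> :: real
  assumes k2: "k \<ge> 2" and f: "f \<in> cube k n \<rightarrow> solid_simplex k" and \<beta>: "\<beta> > 0"
    and infl: "\<And>i j. i \<in> {1..k} \<Longrightarrow> j \<in> {1..n} \<Longrightarrow>
      (\<Sum>a\<in>{1..<k}. (level_one_coeff k n X (\<lambda>w. f w i) (j, a))\<^sup>2) \<le> \<eta>\<^sup>2"
    and \<eta>: "\<eta> \<ge> 0"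
  shows "OBJ k n X f \<le> gaussian_constant k + 2 * k / \<beta> + 48 * \<beta>\<^sup>2 * real k ^ 3 * ((k + 1) * \<eta>)"
proof -
  define v where "v i = level_one_coeff k n X (\<lambda>w. f w i)" for i
  define u where "u ja = - (\<Sum>i\<in>{1..k}. v i ja)" for ja
  define g where "g m w i = f w i + (if i = m then 1 - (\<Sum>l\<in>{1..k}. f w l) else 0)" for m w i
  have v_g: "level_one_coeff k n X (\<lambda>w. g m w i) ja = v i ja + (if i = m then u ja else 0)"
    if "ja \<in> positions n" for m i ja
    \<comment> \<open>The constant 0 covers the components \<open>i \<noteq> m\<close>, the constant
      1 the leading term of the leftover mass.\<close>
    using level_one_const[OF that, of 0] level_one_const[OF that, of 1] unfolding g_def v_def u_def
    by (simp add: level_one_add level_one_diff level_one_sum)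
  have "\<exists>m\<in>{1..k}. 0 \<le> (\<Sum>ja\<in>positions n. 2 * v m ja * u ja + (u ja)\<^sup>2)"
  proof (rule ccontr)
    assume "\<not> ?thesis"
    then have "(\<Sum>m\<in>{1..k}. \<Sum>ja\<in>positions n. 2 * v m ja * u ja + (u ja)\<^sup>2) < (\<Sum>m\<in>{1..k}. 0)"
      using k2 by (intro sum_strict_mono) (auto simp: not_le)
    moreover have "(\<Sum>m\<in>{1..k}. \<Sum>ja\<in>positions n. 2 * v m ja * u ja + (u ja)\<^sup>2)
        = (\<Sum>ja\<in>positions n. (real k - 2) * (u ja)\<^sup>2)"
    proof (subst sum.swap, rule sum.cong[OF refl])
      fix ja
      have "(\<Sum>m\<in>{1..k}. 2 * v m ja * u ja) = - 2 * (u ja)\<^sup>2"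
      proof -
        have "(\<Sum>m\<in>{1..k}. 2 * v m ja * u ja) = 2 * (\<Sum>m\<in>{1..k}. v m ja) * u ja"
          by (simp add: sum_distrib_left sum_distrib_right)
        also have "(\<Sum>m\<in>{1..k}. v m ja) = - u ja" by (simp add: u_def)
        finally show ?thesis by (simp add: power2_eq_square)
      qed
      then show "(\<Sum>m\<in>{1..k}. 2 * v m ja * u ja + (u ja)\<^sup>2) = (real k - 2) * (u ja)\<^sup>2"
        by (simp add: sum.distrib algebra_simps)
    qed
    moreover have "0 \<le> (\<Sum>ja\<in>positions n. (real k - 2) * (u ja)\<^sup>2)"
      using k2 by (intro sum_nonneg) auto
    ultimately show False by simp
  qed
  then obtain m where m: "m \<in> {1..k}" and gain: "0 \<le> (\<Sum>ja\<in>positions n. 2 * v m ja * u ja + (u ja)\<^sup>2)" by blast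
  let ?vg = "\<lambda>i ja. level_one_coeff k n X (\<lambda>w. g m w i) ja"
  have "OBJ k n X f = (\<Sum>i\<in>{1..k}. \<Sum>ja\<in>positions n. (v i ja)\<^sup>2)"
    by (simp add: OBJ_eq v_def)
  also have "\<dots> \<le> (\<Sum>i\<in>{1..k}. (\<Sum>ja\<in>positions n. (v i ja)\<^sup>2)
      + (if i = m then (\<Sum>ja\<in>positions n. 2 * v m ja * u ja + (u ja)\<^sup>2) else 0))"
    using gain by (intro sum_mono) simp
  also have "\<dots> = (\<Sum>i\<in>{1..k}. \<Sum>ja\<in>positions n. (?vg i ja)\<^sup>2)"
    by (intro sum.cong refl) (auto simp: v_g sum.distrib[symmetric] power2_eq_square algebra_simps intro!: sum.cong)
  also have "\<dots> \<le> gaussian_constant k + 2 * k / \<beta> + 48 * \<beta>\<^sup>2 * real k ^ 3 * ((k + 1) * \<eta>)"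
  proof (rule exact_partition_bound[OF _ _ _ _ \<beta>])
    have fs: "f w \<in> solid_simplex k" if "w \<in> cube k n" for w using f that by auto
    show "0 \<le> g m w i" if "w \<in> cube k n" "i \<in> {1..k}" for w i
      using fs[OF that(1)] that(2) by (auto simp: g_def solid_simplex_def)
    show "(\<Sum>i\<in>{1..k}. g m w i) = 1" for w
      using m by (simp add: g_def sum.distrib)
    show "0 \<le> real (k + 1) * \<eta>" using \<eta> by simp
    fix i j assume i: "i \<in> {1..k}" and j: "j \<in> {1..n}"
    have "(?vg i (j, a))\<^sup>2 \<le> (k + 1) * ((v i (j, a))\<^sup>2 + (\<Sum>l\<in>{1..k}. (v l (j, a))\<^sup>2))" if a: "a \<in> {1..<k}" for a
    proof -
      \<comment> \<open>Slot 0 holds the original coefficient and slots 1 to \<open>k\<close> the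
        correction, so Cauchy-Schwarz is applied to \<open>k + 1\<close> terms.\<close>
      define c where "c l = (if l = 0 then v i (j, a) else if i = m then - v l (j, a) else 0)" for l
      have split: "{..k} = insert 0 {1..k}" by auto
      have "?vg i (j, a) = (\<Sum>l\<in>{..k}. c l)"
        unfolding split using j a by (simp add: v_g c_def u_def sum_negf)
      then have "(?vg i (j, a))\<^sup>2 \<le> (\<Sum>l\<in>{..k}. (c l)\<^sup>2) * (k + 1)"
        using sum_squared_le_sum_of_squares[of c "{..k}"] by simp
      also have "(\<Sum>l\<in>{..k}. (c l)\<^sup>2) \<le> (v i (j, a))\<^sup>2 + (\<Sum>l\<in>{1..k}. (v l (j, a))\<^sup>2)"
        unfolding split by (simp add: c_def) (intro sum_mono, auto)
      finally show ?thesis by (simp add: mult.commute mult_right_mono)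
    qed
    then have "(\<Sum>a\<in>{1..<k}. (?vg i (j, a))\<^sup>2)
        \<le> (\<Sum>a\<in>{1..<k}. (k + 1) * ((v i (j, a))\<^sup>2 + (\<Sum>l\<in>{1..k}. (v l (j, a))\<^sup>2)))"
      by (rule sum_mono)
    also have "\<dots> = (k + 1) * ((\<Sum>a\<in>{1..<k}. (v i (j, a))\<^sup>2) + (\<Sum>l\<in>{1..k}. \<Sum>a\<in>{1..<k}. (v l (j, a))\<^sup>2))"
      unfolding sum_distrib_left[symmetric] sum.distrib sum.swap[of _ "{1..k}" "{1..<k}"] ..
    \<comment> \<open>The bracket equals \<open>(k + 1) * \<eta>\<^sup>2\<close>; with the factor in
      front this is a perfect square, which explains the value \<open>(k + 1) * \<eta>\<close> taken
      for \<open>\<delta>\<close>.\<close>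
    also have "\<dots> \<le> (k + 1) * (\<eta>\<^sup>2 + (\<Sum>l\<in>{1..k}. \<eta>\<^sup>2))"
      unfolding v_def by (intro mult_left_mono add_mono sum_mono infl i j) auto
    also have "\<dots> = ((k + 1) * \<eta>)\<^sup>2" by (simp add: power2_eq_square algebra_simps)
    finally show "(\<Sum>a\<in>{1..<k}. (?vg i (j, a))\<^sup>2) \<le> (real (k + 1) * \<eta>)\<^sup>2" .
  qed
  finally show ?thesis .
qed

end

section \<open>Choice of the parameters\<close>

theorem theorem6:
  fixes k :: nat and X :: "nat \<Rightarrow> nat \<Rightarrow> real"
  assumes "k \<ge> 2"
    and "orthonormal_basis k X" and "\<forall>w\<in>omega k. X 0 w = 1"
  shows "\<forall>\<epsilon>>0. \<exists>\<tau>>0. \<forall>n\<ge>1. \<forall>f. f \<in> cube k n \<rightarrow> solid_simplex k \<longrightarrow>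
           (\<forall>i\<in>{1..k}. \<forall>j\<in>{1..n}. low_influence k n X (ln (1 / \<tau>)) j (\<lambda>w. f w i) \<le> \<tau>) \<longrightarrow>
           OBJ k n X f \<le> gaussian_constant k + \<epsilon>"
proof (intro allI impI)
  interpret centred_basis k X by standard (use assms in auto)
  fix \<epsilon> :: real assume \<epsilon>: "\<epsilon> > 0"
  \<comment> \<open>\<open>\<beta>\<close> makes the smoothing error \<open>2 * k / \<beta>\<close>
    equal to \<open>\<epsilon> / 2\<close>, and \<open>\<eta>\<close> then makes the invariance
    error \<open>c * \<eta>\<close> equal to \<open>\<epsilon> / 2\<close>. Both depend on
    \<open>k\<close> and \<open>\<epsilon>\<close> alone.\<close>
  define \<beta> where "\<beta> = 4 * k / \<epsilon>"
  define c where "c = 48 * \<beta>\<^sup>2 * real k ^ 3 * real (k + 1)"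
  define \<eta> where "\<eta> = \<epsilon> / (2 * c)"
  \<comment> \<open>The first bound puts the degree cut-off \<open>ln (1 / \<tau>)\<close> at 1 or
    above, so that level one is included; the second turns the influence hypothesis into the
    required bound \<open>\<eta>\<^sup>2\<close>.\<close>
  define \<tau> where "\<tau> = min (exp (-1)) (\<eta>\<^sup>2)"
  have \<beta>: "\<beta> > 0" using \<epsilon> k_pos by (simp add: \<beta>_def)
  then have c: "c > 0" using k_pos by (simp add: c_def)
  then have \<eta>: "\<eta> > 0" using \<epsilon> by (simp add: \<eta>_def)
  have \<tau>: "\<tau> > 0" using \<eta> by (simp add: \<tau>_def)
  have "ln \<tau> \<le> ln (exp (-1))" using \<tau> by (subst ln_le_cancel_iff) (auto simp: \<tau>_def)
  then have degree: "ln (1 / \<tau>) \<ge> 1" using \<tau> by (simp add: ln_div)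
  show "\<exists>\<tau>>0. \<forall>n\<ge>1. \<forall>f. f \<in> cube k n \<rightarrow> solid_simplex k \<longrightarrow>
           (\<forall>i\<in>{1..k}. \<forall>j\<in>{1..n}. low_influence k n X (ln (1 / \<tau>)) j (\<lambda>w. f w i) \<le> \<tau>) \<longrightarrow>
           OBJ k n X f \<le> gaussian_constant k + \<epsilon>"
  proof (intro exI[of _ \<tau>] conjI \<tau> allI impI)
    fix n :: nat and f
    assume f: "f \<in> cube k n \<rightarrow> solid_simplex k"
      and infl: "\<forall>i\<in>{1..k}. \<forall>j\<in>{1..n}. low_influence k n X (ln (1 / \<tau>)) j (\<lambda>w. f w i) \<le> \<tau>"
    have "(\<Sum>a\<in>{1..<k}. (level_one_coeff k n X (\<lambda>w. f w i) (j, a))\<^sup>2) \<le> \<eta>\<^sup>2"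
      if "i \<in> {1..k}" "j \<in> {1..n}" for i j
    proof -
      have "(\<Sum>a\<in>{1..<k}. (level_one_coeff k n X (\<lambda>w. f w i) (j, a))\<^sup>2)
          \<le> low_influence k n X (ln (1 / \<tau>)) j (\<lambda>w. f w i)"
        by (rule level_one_le_low_influence[OF that(2) degree])
      also have "\<dots> \<le> \<tau>" using infl that by blast
      finally show ?thesis by (simp add: \<tau>_def)
    qed
    then have "OBJ k n X f \<le> gaussian_constant k + 2 * k / \<beta> + 48 * \<beta>\<^sup>2 * real k ^ 3 * ((k + 1) * \<eta>)"
      using less_imp_le[OF \<eta>] by (rule solid_partition_bound[OF assms(1) f \<beta>])
    also have "48 * \<beta>\<^sup>2 * real k ^ 3 * ((k + 1) * \<eta>) = c * \<eta>" by (simp add: c_def)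
    also have "c * \<eta> = \<epsilon> / 2" using c by (simp add: \<eta>_def)
    also have "2 * k / \<beta> = \<epsilon> / 2" using k_pos \<epsilon> by (simp add: \<beta>_def)
    finally show "OBJ k n X f \<le> gaussian_constant k + \<epsilon>" by simp
  qed
qed

end
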